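(* Let $n\ge 4$ be an integer and let $D$ be a degree sequence. Then $D$ excludes $C_n$ if and only if at least one of the following holds: (i) there is a split graph $S$ with split partition $(A,B)$ such that $D$ is the degree sequence of $(S,A,B)\circ C_{n+1}$; (ii) there is a split graph $S$ with split partition $(A,B)$ such that $D$ is the degree sequence of $(S,A,B)\circ C_{n+2}$; (iii) $D$ forcibly excludes each chordless cycle on at least $n$ vertices, that is, no realization of $D$ contains an induced cycle on $n$ or more vertices.
   Context: All graphs are finite and simple. The degree sequence $D(G)$ of a graph $G$ is the sequence of its vertex degrees listed in decreasing (i.e. non-increasing) order; $G$ is then called a realization of $D(G)$. A sequence of nonnegative integers is called a degree sequence if it is $D(G)$ for some graph $G$. For graphs, $G_1\sqsubseteq G_2$ means that $G_1$ is isomorphic to an induced subgraph of $G_2$. For degree sequences, $D_1\preceq D_2$ means that there are realizations $G_1$ of $D_1$ and $G_2$ of $D_2$ with $G_1\sqsubseteq G_2$. A degree sequence $D$ excludes a graph $G$ if $D(G)\not\preceq D$. $C_m$ denotes the cycle on $m$ vertices. A degree sequence $D$ is forcibly-$\mathcal{P}$, for a graph property $\mathcal{P}$, if every realization of $D$ has property $\mathcal{P}$. A set of vertices is complete (anticomplete) if every two (no two) distinct vertices in it are adjacent. A graph $S$ is split if its vertex set has a partition $(A,B)$ with $A$ complete and $B$ anticomplete; such an $(A,B)$ is called a split partition of $S$. The sets $A$ and $B$ may be empty, and the graph with no vertices counts as a split graph. For a split graph $S$ with split partition $(A,B)$ and a graph $H$ (with vertex set disjoint from $V(S)$), $(S,A,B)\circ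 H$ is the graph with vertex set $V(S)\cup V(H)$ obtained from the disjoint union of $S$ and $H$ by making every vertex of $H$ adjacent to every vertex of $A$ and to no vertex of $B$. *)

theory Defs
  imports "Graph_Theory.Digraph_Isomorphism" "HOL-Library.Multiset"
begin

text \<open>
  A finite simple graph is a \<open>pair_graph\<close>: a finite, loop-free, symmetric digraph whose arcs are
  pairs of vertices, each edge being represented by its two orientations. Hence the degree of a
  vertex is its \<open>out_degree\<close>, and \<open>digraph_iso\<close> and \<open>induced_subgraph\<close> are the usual notions for
  undirected graphs. The null graph is a \<open>pair_graph\<close>.
\<close>

definition degree_seq :: "'a pair_pre_digraph \<Rightarrow> nat list" where
  "degree_seq G =
    rev (sorted_list_of_multiset (image_mset (out_degree (with_proj G)) (mset_set (pverts G))))"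

text \<open>
  Every finite graph is isomorphic to one whose vertices are natural numbers, so realizations may be
  taken over \<open>nat\<close>; the lemma \<open>degree_sequence_degree_seq\<close> below confirms this.
\<close>

definition realization :: "nat pair_pre_digraph \<Rightarrow> nat list \<Rightarrow> bool" where
  "realization G D \<longleftrightarrow> pair_graph G \<and> degree_seq G = D"

definition degree_sequence :: "nat list \<Rightarrow> bool" where
  "degree_sequence D \<longleftrightarrow> (\<exists>G. realization G D)"

definition forcibly :: "(nat pair_pre_digraph \<Rightarrow> bool) \<Rightarrow> nat list \<Rightarrow> bool" where
  "forcibly P D \<longleftrightarrow> (\<forall>G. realization G D \<longrightarrow> P G)"

definition embeds :: "'a pair_pre_digraph \<Rightarrow> 'b pair_pre_digraph \<Rightarrow> bool"
    (infix \<open>\<sqsubseteq>\<^sub>g\<close> 50) where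
  "G\<^sub>1 \<sqsubseteq>\<^sub>g G\<^sub>2 \<longleftrightarrow>
    (\<exists>H. induced_subgraph H (with_proj G\<^sub>2) \<and> digraph_iso (with_proj G\<^sub>1) H)"

definition seq_embeds :: "nat list \<Rightarrow> nat list \<Rightarrow> bool" (infix \<open>\<preceq>\<^sub>d\<close> 50) where
  "D\<^sub>1 \<preceq>\<^sub>d D\<^sub>2 \<longleftrightarrow>
    (\<exists>G\<^sub>1 G\<^sub>2. realization G\<^sub>1 D\<^sub>1 \<and> realization G\<^sub>2 D\<^sub>2 \<and> G\<^sub>1 \<sqsubseteq>\<^sub>g G\<^sub>2)"

definition excludes :: "nat list \<Rightarrow> 'a pair_pre_digraph \<Rightarrow> bool" where
  "excludes D G \<longleftrightarrow> \<not> degree_seq G \<preceq>\<^sub>d D"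

text \<open>The cycle on \<open>m\<close> vertices; meaningful only for \<open>m \<ge> 3\<close>.\<close>

definition cycle_graph :: "nat \<Rightarrow> nat pair_pre_digraph" where
  "cycle_graph m = \<lparr> pverts = {..<m},
     parcs = {(i, j). i < m \<and> j < m \<and> (j = Suc i mod m \<or> i = Suc j mod m)} \<rparr>"

definition complete_set :: "'a pair_pre_digraph \<Rightarrow> 'a set \<Rightarrow> bool" where
  "complete_set G A \<longleftrightarrow> (\<forall>u\<in>A. \<forall>v\<in>A. u \<noteq> v \<longrightarrow> (u, v) \<in> parcs G)"

definition anticomplete_set :: "'a pair_pre_digraph \<Rightarrow> 'a set \<Rightarrow> bool" where
  "anticomplete_set G B \<longleftrightarrow> (\<forall>u\<in>B. \<forall>v\<in>B. u \<noteq> v \<longrightarrow> (u, v) \<notin> parcs G)"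

definition split_partition :: "'a pair_pre_digraph \<Rightarrow> 'a set \<Rightarrow> 'a set \<Rightarrow> bool" where
  "split_partition S A B \<longleftrightarrow> pverts S = A \<union> B \<and> A \<inter> B = {} \<and>
     complete_set S A \<and> anticomplete_set S B"

definition split_graph :: "'a pair_pre_digraph \<Rightarrow> bool" where
  "split_graph S \<longleftrightarrow> pair_graph S \<and> (\<exists>A B. split_partition S A B)"

text \<open>
  \<open>(S, A, B) \<circ> H\<close>, meaningful only if \<open>S\<close> and \<open>H\<close> have disjoint vertex sets. The argument \<open>B\<close> is kept
  for the notation only: no arcs between \<open>H\<close> and \<open>B\<close> are added.
\<close>

definition split_compose ::
    "'a pair_pre_digraph \<Rightarrow> 'a set \<Rightarrow> 'a set \<Rightarrow> 'a pair_pre_digraph \<Rightarrow> 'a pair_pre_digraph" where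
  "split_compose S A B H = \<lparr> pverts = pverts S \<union> pverts H,
     parcs = parcs S \<union> parcs H \<union> A \<times> pverts H \<union> pverts H \<times> A \<rparr>"

lemma pair_graph_iff:
  "pair_graph G \<longleftrightarrow> finite (pverts G) \<and> parcs G \<subseteq> pverts G \<times> pverts G \<and>
     sym (parcs G) \<and> irrefl (parcs G)" (is "?L \<longleftrightarrow> ?R")
proof
  assume ?L
  then interpret pair_graph G .
  show ?R
    using pair_finite_verts in_arcsD1 in_arcsD2 arcs_symmetric no_loops'
    by (fastforce simp: sym_def irrefl_def)
next
  assume R: ?R
  then have "finite (parcs G)" by (meson finite_SigmaI finite_subset)
  with R show ?L
    by unfold_locales (auto simp: symmetric_def irrefl_def)
qed

lemma pair_graph_cycle_graph:
  assumes "m \<ge> 3"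
  shows "pair_graph (cycle_graph m)"
  using assms
  by (auto simp: pair_graph_iff cycle_graph_def sym_def irrefl_def mod_Suc split: if_splits)

lemma pair_graph_split_compose:
  assumes "pair_graph S" "split_partition S A B" "pair_graph H" "pverts S \<inter> pverts H = {}"
  shows "pair_graph (split_compose S A B H)"
  using assms unfolding pair_graph_iff split_partition_def split_compose_def sym_def irrefl_def
  by auto

lemma embeds_iff:
  assumes "pair_graph G\<^sub>1" "pair_graph G\<^sub>2"
  shows "G\<^sub>1 \<sqsubseteq>\<^sub>g G\<^sub>2 \<longleftrightarrow> (\<exists>f. inj_on f (pverts G\<^sub>1) \<and> f ` pverts G\<^sub>1 \<subseteq> pverts G\<^sub>2 \<and>
    (\<forall>u\<in>pverts G\<^sub>1. \<forall>v\<in>pverts G\<^sub>1. (f u, f v) \<in> parcs G\<^sub>2 \<longleftrightarrow> (u, v) \<in> parcs G\<^sub>1))"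
    (is "?L \<longleftrightarrow> ?R")
proof
  interpret G1: pair_graph G\<^sub>1 by fact
  assume ?L
  then obtain h where ind: "induced_subgraph (app_iso h (with_proj G\<^sub>1)) (with_proj G\<^sub>2)"
    and iso: "pre_digraph.digraph_isomorphism (with_proj G\<^sub>1) h"
    unfolding embeds_def digraph_iso_def by blast
  define f where "f = iso_verts h"
  have th: "iso_tail h = fst" "iso_head h = snd"
    using ind by (auto simp: induced_subgraph_def subgraph_def compatible_def)
  have inj: "inj_on f (pverts G\<^sub>1)"
    using iso by (simp add: pre_digraph.digraph_isomorphism_def f_def)
  have arc: "iso_arcs h (u, v) = (f u, f v)" if "(u, v) \<in> parcs G\<^sub>1" for u v
    using iso that by (auto simp: pre_digraph.digraph_isomorphism_def f_def th prod_eq_iff)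
  have sub: "f ` pverts G\<^sub>1 \<subseteq> pverts G\<^sub>2"
    using ind by (auto simp: induced_subgraph_def subgraph_def f_def)
  have arcs: "iso_arcs h ` parcs G\<^sub>1 =
      {e \<in> parcs G\<^sub>2. fst e \<in> f ` pverts G\<^sub>1 \<and> snd e \<in> f ` pverts G\<^sub>1}"
    using ind by (simp add: induced_subgraph_def th f_def)
  have "(f u, f v) \<in> parcs G\<^sub>2 \<longleftrightarrow> (u, v) \<in> parcs G\<^sub>1"
    if uv: "u \<in> pverts G\<^sub>1" "v \<in> pverts G\<^sub>1" for u v
  proof
    assume "(f u, f v) \<in> parcs G\<^sub>2"
    then have "(f u, f v) \<in> iso_arcs h ` parcs G\<^sub>1" using arcs uv by auto
    then obtain x y where xy: "(x, y) \<in> parcs G\<^sub>1" "(f u, f v) = iso_arcs h (x, y)" by auto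
    then have "x \<in> pverts G\<^sub>1" "y \<in> pverts G\<^sub>1" using G1.in_arcsD1 G1.in_arcsD2 by blast+
    moreover have "f u = f x" "f v = f y" using xy arc by auto
    ultimately show "(u, v) \<in> parcs G\<^sub>1" using xy(1) inj uv by (auto dest: inj_onD)
  next
    assume "(u, v) \<in> parcs G\<^sub>1"
    then have "(f u, f v) \<in> iso_arcs h ` parcs G\<^sub>1" using arc by (metis image_eqI)
    then show "(f u, f v) \<in> parcs G\<^sub>2" using arcs by auto
  qed
  then show ?R using inj sub by blast
next
  interpret G1: pair_graph G\<^sub>1 by fact
  interpret G2: pair_graph G\<^sub>2 by fact
  assume ?R
  then obtain f where f: "inj_on f (pverts G\<^sub>1)" "f ` pverts G\<^sub>1 \<subseteq> pverts G\<^sub>2"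
    "\<And>u v. u \<in> pverts G\<^sub>1 \<Longrightarrow> v \<in> pverts G\<^sub>1 \<Longrightarrow> (f u, f v) \<in> parcs G\<^sub>2 \<longleftrightarrow> (u, v) \<in> parcs G\<^sub>1"
    by blast
  define h where "h = \<lparr> iso_verts = f, iso_arcs = map_prod f f,
    iso_head = (snd :: 'b \<times> 'b \<Rightarrow> 'b), iso_tail = fst \<rparr>"
  have "wf_digraph (with_proj G\<^sub>1)" by (rule G1.wf_digraph)
  moreover have "inj_on (map_prod f f) (parcs G\<^sub>1)"
    by (rule inj_on_subset[OF map_prod_inj_on[OF f(1) f(1)]])
      (use assms(1) in \<open>simp add: pair_graph_iff\<close>)
  ultimately have "pre_digraph.digraph_isomorphism (with_proj G\<^sub>1) h"
    using f(1) by (auto simp: pre_digraph.digraph_isomorphism_def h_def)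
  moreover have "with_proj G\<^sub>2 \<restriction> (f ` pverts G\<^sub>1) = app_iso h (with_proj G\<^sub>1)"
  proof -
    have "{e \<in> parcs G\<^sub>2. fst e \<in> f ` pverts G\<^sub>1 \<and> snd e \<in> f ` pverts G\<^sub>1} =
        map_prod f f ` parcs G\<^sub>1" (is "?A = ?B")
    proof
      show "?A \<subseteq> ?B"
      proof
        fix e assume "e \<in> ?A"
        then obtain u v where uv: "u \<in> pverts G\<^sub>1" "v \<in> pverts G\<^sub>1" "e = (f u, f v)" "e \<in> parcs G\<^sub>2"
          by (cases e) auto
        then have "(u, v) \<in> parcs G\<^sub>1" using f(3) by simp
        then show "e \<in> ?B" using uv(3) by (auto simp: image_iff intro!: bexI[of _ "(u, v)"])
      qed
      show "?B \<subseteq> ?A"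
        using f(3) by (auto simp: G1.in_arcsD1 G1.in_arcsD2)
    qed
    then show ?thesis by (simp add: induce_subgraph_def app_iso_def h_def)
  qed
  moreover have "induced_subgraph (with_proj G\<^sub>2 \<restriction> (f ` pverts G\<^sub>1)) (with_proj G\<^sub>2)"
    using G2.induced_induce f(2) by auto
  ultimately show ?L unfolding embeds_def digraph_iso_def by metis
qed

lemma degree_sequence_degree_seq:
  fixes G :: "'a pair_pre_digraph"
  assumes "pair_graph G"
  shows "degree_sequence (degree_seq G)"
proof -
  interpret pair_graph G by fact
  obtain f :: "'a \<Rightarrow> nat" where f: "inj_on f (pverts G)"
    using finite_imp_inj_to_nat_seg[OF pair_finite_verts] by blast
  define G' where "G' = \<lparr> pverts = f ` pverts G, parcs = map_prod f f ` parcs G \<rparr>"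
  have sub: "parcs G \<subseteq> pverts G \<times> pverts G"
    using assms by (simp add: pair_graph_iff)
  have inj: "inj_on (map_prod f f) (parcs G)"
    using map_prod_inj_on[OF f f] sub by (rule inj_on_subset)
  have "pair_graph G'"
    unfolding pair_graph_iff
  proof (intro conjI)
    show "irrefl (parcs G')"
    proof (rule irreflI)
      fix x show "(x, x) \<notin> parcs G'"
      proof
        assume "(x, x) \<in> parcs G'"
        then obtain u v where uv: "(u, v) \<in> parcs G" "f u = f v"
          by (auto simp: G'_def)
        then have "u = v"
          using inj_onD[OF f] in_arcsD1 in_arcsD2 by blast
        then show False using uv(1) no_loops' by blast
      qed
    qed
    show "sym (parcs G')"
    proof (rule symI)
      fix x y assume "(x, y) \<in> parcs G'"
      then obtain u v where uv: "(u, v) \<in> parcs G" "x = f u" "y = f v"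
        by (auto simp: G'_def)
      have "map_prod f f (v, u) \<in> map_prod f f ` parcs G"
        using arcs_symmetric[OF uv(1)] by (rule imageI)
      then show "(y, x) \<in> parcs G'" using uv by (simp add: G'_def)
    qed
    show "parcs G' \<subseteq> pverts G' \<times> pverts G'"
      using sub by (auto simp: G'_def)
  qed (simp add: G'_def pair_finite_verts)
  moreover have deg: "out_degree (with_proj G') (f v) = out_degree (with_proj G) v"
    if "v \<in> pverts G" for v
  proof -
    have "{e \<in> map_prod f f ` parcs G. fst e = f v} = map_prod f f ` {e \<in> parcs G. fst e = v}"
      using inj_onD[OF f _ in_arcsD1 that] by (auto intro!: map_prod_imageI)
    moreover have "inj_on (map_prod f f) {e \<in> parcs G. fst e = v}"
      using inj by (rule inj_on_subset) auto
    ultimately show ?thesis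
      by (simp add: out_degree_def out_arcs_def G'_def card_image)
  qed
  have "degree_seq G' = degree_seq G"
  proof -
    have "mset_set (pverts G') = image_mset f (mset_set (pverts G))"
      using f by (simp add: G'_def image_mset_mset_set)
    then have "image_mset (out_degree (with_proj G')) (mset_set (pverts G')) =
        image_mset (\<lambda>v. out_degree (with_proj G') (f v)) (mset_set (pverts G))"
      by (simp add: multiset.map_comp comp_def)
    also have "\<dots> = image_mset (out_degree (with_proj G)) (mset_set (pverts G))"
      using deg pair_finite_verts by (intro image_mset_cong) auto
    finally show ?thesis by (simp add: degree_seq_def)
  qed
  ultimately show ?thesis
    unfolding degree_sequence_def realization_def by blast
qed

end

theory Submission
  imports Defs
begin

text \<open>
  Whenever the edges inside a vertex set \<open>X\<close> of a realization of \<open>D\<close> are replaced by another graph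
  on \<open>X\<close> with the same degrees, the result is again a realization of \<open>D\<close>. Hence \<open>D\<close> excludes \<open>C\<^sub>n\<close>
  iff no realization has an induced 2-regular subgraph on \<open>n\<close> vertices. Suppose this holds and some
  realization has an induced cycle \<open>C\<close> on \<open>m > n\<close> vertices. If \<open>m \<ge> n + 3\<close>, replace \<open>C\<close> by two cycles,
  one of length \<open>n\<close>. Otherwise \<open>C\<close> together with a vertex that is neither complete nor
  anticomplete to \<open>C\<close>, or with two nonadjacent vertices complete to \<open>C\<close>, or with two adjacent
  vertices anticomplete to \<open>C\<close>, can be rewired so as to contain an induced \<open>C\<^sub>n\<close>. So the realization
  is \<open>(S, A, B) \<circ> C\<close>. Conversely, by comparing the degree sums over \<open>A\<close> and over \<open>B\<close>, every
  realization of the degree sequence of \<open>(S, A, B) \<circ> C\<^sub>m\<close> has the form \<open>(S', A', B') \<circ> H\<close> with \<open>H\<close>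
  2-regular on \<open>m\<close> vertices; an induced 2-regular subgraph on \<open>n \<ge> 4\<close> vertices lies inside \<open>H\<close>, and
  then \<open>m = n\<close> or \<open>m \<ge> n + 3\<close>.
\<close>

subsection \<open>Degrees and replacement of induced subgraphs\<close>

text \<open>Stated for bare relations rather than graphs, so that edge sets can be cut apart and
  glued together without carrying a vertex set along.\<close>

definition deg :: "'a rel \<Rightarrow> 'a \<Rightarrow> nat" where
  "deg R u = card (R `` {u})"

definition graph_on :: "'a rel \<Rightarrow> 'a set \<Rightarrow> bool" where
  "graph_on R X \<longleftrightarrow> R \<subseteq> X \<times> X \<and> sym R \<and> irrefl R"

text \<open>A degree sequence cannot tell a cycle from a disjoint union of cycles; 2-regularity of
  the induced subgraph is the part of being a cycle that degrees do see.\<close>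

definition two_regular :: "'a rel \<Rightarrow> 'a set \<Rightarrow> bool" where
  "two_regular R W \<longleftrightarrow> (\<forall>w\<in>W. deg (Restr R W) w = 2)"

text \<open>Rewirings are written as unions of disjoint stars, so that \<open>deg_Un\<close> and
  \<open>deg_star\<close> compute every degree.\<close>

definition star :: "'a \<Rightarrow> 'a set \<Rightarrow> 'a rel" where
  "star v N = {v} \<times> N \<union> N \<times> {v}"

text \<open>The shape of \<open>(S, A, B) \<circ> H\<close> seen inside a single graph: arcs between
  \<open>A\<close> and \<open>B\<close> and arcs inside \<open>H\<close> are left free.\<close>

definition decomposed :: "'a rel \<Rightarrow> 'a set \<Rightarrow> 'a set \<Rightarrow> 'a set \<Rightarrow> bool" where
  "decomposed R A B H \<longleftrightarrow> A \<inter> B = {} \<and> A \<inter> H = {} \<and> B \<inter> H = {} \<and>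
    A \<times> A - Id \<subseteq> R \<and> R \<inter> B \<times> B = {} \<and> A \<times> H \<subseteq> R \<and> R \<inter> B \<times> H = {}"

section \<open>Degrees in disjoint unions and in stars\<close>

lemma deg_Un:
  assumes "finite R" "finite T" "R \<inter> T = {}"
  shows "deg (R \<union> T) u = deg R u + deg T u"
proof -
  have "(R \<union> T) `` {u} = R `` {u} \<union> T `` {u}" by auto
  moreover have "R `` {u} \<inter> T `` {u} = {}" using assms by auto
  moreover have "finite (R `` {u})" "finite (T `` {u})" using assms by (auto simp: finite_Image)
  ultimately show ?thesis by (simp add: deg_def card_Un_disjoint)
qed

lemma deg_outside: "R \<subseteq> X \<times> Y \<Longrightarrow> u \<notin> X \<Longrightarrow> deg R u = 0"
proof -
  assume "R \<subseteq> X \<times> Y" "u \<notin> X"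
  then have "R `` {u} = {}" by auto
  then show ?thesis by (simp add: deg_def)
qed

lemma deg_empty: "deg {} u = 0"
  by (simp add: deg_def)

lemma deg_star:
  assumes "v \<notin> N"
  shows "deg (star v N) u = (if u = v then card N else if u \<in> N then 1 else 0)"
proof -
  have "star v N `` {u} = (if u = v then N else if u \<in> N then {v} else {})"
    using assms by (auto simp: star_def)
  then show ?thesis by (auto simp: deg_def)
qed

lemma star_disjoint: "v \<noteq> w \<Longrightarrow> v \<notin> M \<or> w \<notin> N \<Longrightarrow> star v N \<inter> star w M = {}"
  by (auto simp: star_def)

lemma finite_star: "finite N \<Longrightarrow> finite (star v N)"
  by (simp add: star_def)

lemma graph_on_star: "v \<in> X \<Longrightarrow> N \<subseteq> X \<Longrightarrow> v \<notin> N \<Longrightarrow> graph_on (star v N) X"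
  by (auto simp: graph_on_def star_def sym_def irrefl_def)

lemma graph_on_Un: "graph_on R X \<Longrightarrow> graph_on T X \<Longrightarrow> graph_on (R \<union> T) X"
  by (auto simp: graph_on_def sym_def irrefl_def)

lemma graph_on_mono: "graph_on R X \<Longrightarrow> X \<subseteq> Y \<Longrightarrow> graph_on R Y"
  by (auto simp: graph_on_def)

lemma graph_on_finite: "graph_on R X \<Longrightarrow> finite X \<Longrightarrow> finite R"
  unfolding graph_on_def by (metis finite_SigmaI finite_subset)

section \<open>Degree sequences and degree-preserving bijections\<close>

lemma pair_graph_iff_graph_on:
  "pair_graph G \<longleftrightarrow> finite (pverts G) \<and> graph_on (parcs G) (pverts G)"
  by (auto simp: pair_graph_iff graph_on_def)

lemma out_degree_eq_deg: "out_degree (with_proj G) v = deg (parcs G) v"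
proof -
  have "{e \<in> parcs G. fst e = v} = Pair v ` (parcs G `` {v})" by (auto simp: image_iff)
  then show ?thesis
    by (simp add: out_degree_def out_arcs_def deg_def card_image inj_on_def)
qed

lemma degree_seq_eq_iff:
  "degree_seq G = degree_seq H \<longleftrightarrow>
    image_mset (deg (parcs G)) (mset_set (pverts G)) = image_mset (deg (parcs H)) (mset_set (pverts H))"
proof -
  have eq: "out_degree (with_proj G) = deg (parcs G)" for G :: "'c pair_pre_digraph"
    by (rule ext) (rule out_degree_eq_deg)
  show ?thesis
    unfolding degree_seq_def eq rev_is_rev_conv by (metis mset_sorted_list_of_multiset)
qed

lemma degree_seq_eqI:
  assumes "bij_betw h (pverts G) (pverts H)"
    and "\<And>u. u \<in> pverts G \<Longrightarrow> deg (parcs H) (h u) = deg (parcs G) u"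
  shows "degree_seq G = degree_seq H"
proof -
  have "mset_set (pverts H) = image_mset h (mset_set (pverts G))"
    using assms(1) by (metis bij_betw_def image_mset_mset_set)
  then have "image_mset (deg (parcs H)) (mset_set (pverts H)) =
      image_mset (\<lambda>u. deg (parcs H) (h u)) (mset_set (pverts G))"
    by (simp add: multiset.map_comp comp_def)
  also have "\<dots> = image_mset (deg (parcs G)) (mset_set (pverts G))"
    by (rule image_mset_cong) (metis assms(2) elem_mset_set empty_iff mset_set.infinite set_mset_empty)
  finally show ?thesis by (simp add: degree_seq_eq_iff)
qed

text \<open>For two realizations of one degree sequence this gives a bijection that preserves
  degrees, though not adjacency; along it a vertex partition is carried from one realization to the
  other.\<close>

lemma image_mset_eq_bij:
  assumes "finite X" "finite Y" "image_mset f (mset_set X) = image_mset g (mset_set Y)"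
  obtains h where "bij_betw h X Y" "\<And>x. x \<in> X \<Longrightarrow> g (h x) = f x"
proof -
  have "\<exists>h. bij_betw h X Y \<and> (\<forall>x\<in>X. g (h x) = f x)"
    using assms
  proof (induction X arbitrary: Y rule: finite_induct)
    case empty
    then have "Y = {}" by (auto simp: mset_set_empty_iff)
    then show ?case by (simp add: bij_betw_def)
  next
    case (insert x X)
    then have "f x \<in># image_mset g (mset_set Y)" by (metis finite.insertI image_mset_add_mset mset_set.insert union_single_eq_member)
    then obtain y where y: "y \<in> Y" "g y = f x" using insert.prems(1) by auto
    have "mset_set Y = add_mset y (mset_set (Y - {y}))"
      using y insert.prems(1) by (simp add: mset_set.remove)
    then have "image_mset f (mset_set X) = image_mset g (mset_set (Y - {y}))"
      using insert y by simp
    then obtain h where h: "bij_betw h X (Y - {y})" "\<forall>x\<in>X. g (h x) = f x"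
      using insert.IH[of "Y - {y}"] insert.prems(1) by auto
    have "bij_betw (h(x := y)) X (Y - {y})"
      using h(1) insert.hyps(2) by (metis bij_betw_cong fun_upd_other)
    then have "bij_betw (h(x := y)) (insert x X) Y"
      using y(1) insert.hyps(2) by (auto simp: bij_betw_def)
    then show ?case using h(2) y insert.hyps(2) by (metis fun_upd_other fun_upd_same insert_iff)
  qed
  then show ?thesis using that by blast
qed

lemma deg_iso:
  assumes "bij_betw h X Y" "R \<subseteq> X \<times> X" "T \<subseteq> Y \<times> Y"
    and "\<And>u v. u \<in> X \<Longrightarrow> v \<in> X \<Longrightarrow> (h u, h v) \<in> T \<longleftrightarrow> (u, v) \<in> R" and "u \<in> X"
  shows "deg T (h u) = deg R u"
proof -
  have "T `` {h u} = h ` (R `` {u})"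
  proof
    show "T `` {h u} \<subseteq> h ` (R `` {u})"
    proof
      fix y assume "y \<in> T `` {h u}"
      then have y: "(h u, y) \<in> T" by simp
      then obtain v where "v \<in> X" "y = h v" using assms(1,3) by (auto simp: bij_betw_def)
      then show "y \<in> h ` (R `` {u})" using y assms(4,5) by auto
    qed
    show "h ` (R `` {u}) \<subseteq> T `` {h u}" using assms(2,4,5) by auto
  qed
  moreover have "inj_on h (R `` {u})"
    using assms(1,2) by (auto simp: bij_betw_def inj_on_def)
  ultimately show ?thesis by (simp add: deg_def card_image)
qed

section \<open>Cycles, and exchanging the edges inside a vertex set\<close>

lemma deg_cycle_graph:
  assumes "m \<ge> 3" "i < m"
  shows "deg (parcs (cycle_graph m)) i = 2"
proof -
  \<comment> \<open>The predecessor modulo \<open>m\<close> is written by cases because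
    \<open>i - 1\<close> truncates at \<open>0\<close>.\<close>
  have "parcs (cycle_graph m) `` {i} = {Suc i mod m, if i = 0 then m - 1 else i - 1}"
    using assms by (auto simp: cycle_graph_def mod_Suc split: if_splits)
  \<comment> \<open>This rests on \<open>m \<ge> 3\<close>: for \<open>m = 2\<close> the two
    neighbours coincide.\<close>
  moreover have "Suc i mod m \<noteq> (if i = 0 then m - 1 else i - 1)"
    using assms by (auto simp: mod_Suc)
  ultimately show ?thesis by (simp add: deg_def)
qed

text \<open>Source of the cycles that get planted on vertex sets; \<open>h\<close> later turns such
  an \<open>F\<close> into an embedding of \<open>cycle_graph m\<close>.\<close>

lemma cycle_graph_on:
  assumes "finite W" "card W = m" "m \<ge> 3"
  obtains F h where "graph_on F W" "\<And>w. w \<in> W \<Longrightarrow> deg F w = 2" "bij_betw h {..<m} W"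
    "\<And>i j. i < m \<Longrightarrow> j < m \<Longrightarrow> (h i, h j) \<in> F \<longleftrightarrow> (i, j) \<in> parcs (cycle_graph m)"
proof -
  let ?E = "parcs (cycle_graph m)"
  obtain h where h: "bij_betw h {..<m} W"
    using assms(1,2) by (metis atLeast0LessThan ex_bij_betw_nat_finite)
  define F where "F = map_prod h h ` ?E"
  have E: "graph_on ?E {..<m}"
    using pair_graph_cycle_graph[OF assms(3)]
    by (simp add: pair_graph_iff_graph_on cycle_graph_def)
  have iff: "(h i, h j) \<in> F \<longleftrightarrow> (i, j) \<in> ?E" if "i < m" "j < m" for i j
  proof
    assume "(h i, h j) \<in> F"
    then obtain a b where ab: "(a, b) \<in> ?E" "h i = h a" "h j = h b" by (auto simp: F_def)
    then have "a < m" "b < m" using E by (auto simp: graph_on_def)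
    then have "i = a" "j = b"
      using ab h that by (auto simp: bij_betw_def dest: inj_onD)
    then show "(i, j) \<in> ?E" using ab by simp
  qed (auto simp: F_def)
  have sub: "F \<subseteq> W \<times> W" using E h by (auto simp: F_def graph_on_def bij_betw_def)
  have W: "\<exists>i<m. h i = w" if "w \<in> W" for w using h that by (auto simp: bij_betw_def)
  have "sym F" using E by (auto simp: F_def graph_on_def sym_def)
  moreover have "irrefl F"
  proof (rule irreflI)
    fix x show "(x, x) \<notin> F"
    proof
      assume "(x, x) \<in> F"
      with sub W obtain i where "i < m" "(h i, h i) \<in> F" by blast
      then show False using iff E by (auto simp: graph_on_def irrefl_def)
    qed
  qed
  ultimately have "graph_on F W" using sub by (simp add: graph_on_def)
  moreover have "deg F w = 2" if w: "w \<in> W" for w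
  proof -
    obtain i where i: "i < m" "h i = w" using W[OF w] by blast
    have "deg F (h i) = deg ?E i"
      by (rule deg_iso[OF h _ sub]) (use E iff i in \<open>auto simp: graph_on_def\<close>)
    then show ?thesis using i deg_cycle_graph assms(3) by simp
  qed
  ultimately show ?thesis using that h iff by blast
qed

lemma embedded_cycle_two_regular:
  assumes "pair_graph G" "m \<ge> 3" "cycle_graph m \<sqsubseteq>\<^sub>g G"
  obtains f where "bij_betw f {..<m} (f ` {..<m})" "f ` {..<m} \<subseteq> pverts G"
    "\<forall>i<m. \<forall>j<m. (f i, f j) \<in> parcs G \<longleftrightarrow> (i, j) \<in> parcs (cycle_graph m)"
    "two_regular (parcs G) (f ` {..<m})"
proof -
  let ?E = "parcs (cycle_graph m)"
  have v: "pverts (cycle_graph m) = {..<m}" by (simp add: cycle_graph_def)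
  obtain f where f: "inj_on f {..<m}" "f ` {..<m} \<subseteq> pverts G"
    "\<And>i j. i < m \<Longrightarrow> j < m \<Longrightarrow> (f i, f j) \<in> parcs G \<longleftrightarrow> (i, j) \<in> ?E"
    using assms embeds_iff[OF pair_graph_cycle_graph[OF assms(2)] assms(1)] unfolding v by auto
  then have bij: "bij_betw f {..<m} (f ` {..<m})" by (simp add: bij_betw_def)
  have "deg (Restr (parcs G) (f ` {..<m})) (f i) = deg ?E i" if "i < m" for i
    by (rule deg_iso[OF bij]) (use f(3) that in \<open>auto simp: cycle_graph_def\<close>)
  then have "two_regular (parcs G) (f ` {..<m})"
    using deg_cycle_graph assms(2) by (auto simp: two_regular_def)
  then show ?thesis using that f bij by blast
qed

text \<open>Each degree is the sum of a part outside \<open>X \<times> X\<close>, which is kept, and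
  a part inside, which the exchange leaves numerically the same. Vertices outside \<open>X\<close>
  have inner degree 0 before and after.\<close>

lemma replace_induced:
  assumes G: "realization G D" and X: "X \<subseteq> pverts G" and F: "graph_on F X"
    and deg: "\<And>x. x \<in> X \<Longrightarrow> deg F x = deg (Restr (parcs G) X) x"
  obtains G' where "realization G' D" "pverts G' = pverts G" "Restr (parcs G') X = F"
proof -
  let ?E = "parcs G"
  define G' where "G' = \<lparr>pverts = pverts G, parcs = (?E - X \<times> X) \<union> F\<rparr>"
  have E: "finite (pverts G)" "graph_on ?E (pverts G)"
    using G by (auto simp: realization_def pair_graph_iff_graph_on)
  have fin: "finite ?E" "finite F"
    using E F X graph_on_finite finite_subset[OF X E(1)] by blast+
  have "graph_on (?E - X \<times> X) (pverts G)" using E by (auto simp: graph_on_def sym_def irrefl_def)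
  then have "pair_graph G'"
    using E F X by (simp add: G'_def pair_graph_iff_graph_on graph_on_Un graph_on_mono)
  moreover have "deg (parcs G') u = deg ?E u" for u
  proof -
    have "deg F u = deg (Restr ?E X) u"
    proof (cases "u \<in> X")
      case False
      then show ?thesis using F by (metis deg_outside graph_on_def Int_lower2)
    qed (rule deg)
    moreover have "deg (parcs G') u = deg (?E - X \<times> X) u + deg F u"
      unfolding G'_def pair_pre_digraph.select_convs
      by (rule deg_Un) (use fin F in \<open>auto simp: graph_on_def\<close>)
    moreover have "deg ((?E - X \<times> X) \<union> Restr ?E X) u = deg (?E - X \<times> X) u + deg (Restr ?E X) u"
      by (rule deg_Un) (use fin in auto)
    moreover have "(?E - X \<times> X) \<union> Restr ?E X = ?E" by auto
    ultimately show ?thesis by simp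
  qed
  then have "degree_seq G' = degree_seq G"
    by (intro degree_seq_eqI[of id]) (auto simp: G'_def)
  ultimately have "realization G' D" using G by (simp add: realization_def)
  moreover have "Restr (parcs G') X = F" using F by (auto simp: G'_def graph_on_def)
  ultimately show ?thesis using that by (simp add: G'_def)
qed

text \<open>The degree sequence of the cycle consists of \<open>n\<close> twos, so its realizations
  are all 2-regular graphs on \<open>n\<close> vertices, connected or not. This removes isomorphism
  and embeddings from the rest of the argument.\<close>

lemma excludes_cycle_iff:
  assumes "n \<ge> 3"
  shows "excludes D (cycle_graph n) \<longleftrightarrow>
    (\<forall>G W. realization G D \<longrightarrow> W \<subseteq> pverts G \<longrightarrow> card W = n \<longrightarrow> \<not> two_regular (parcs G) W)"
proof -
  let ?C = "cycle_graph n"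
  have "image_mset (deg (parcs ?C)) (mset_set (pverts ?C)) = image_mset (\<lambda>_. 2) (mset_set (pverts ?C))"
    using deg_cycle_graph[OF assms] by (intro image_mset_cong) (simp add: cycle_graph_def)
  then have C: "image_mset (deg (parcs ?C)) (mset_set (pverts ?C)) = replicate_mset n 2"
    by (simp add: image_mset_const_eq cycle_graph_def)
  have seq: "degree_seq G = degree_seq ?C \<longleftrightarrow> card (pverts G) = n \<and> (\<forall>v\<in>pverts G. deg (parcs G) v = 2)"
    if "finite (pverts G)" for G :: "nat pair_pre_digraph"
  proof
    assume "degree_seq G = degree_seq ?C"
    then have eq: "image_mset (deg (parcs G)) (mset_set (pverts G)) = replicate_mset n 2"
      by (simp add: degree_seq_eq_iff C)
    then have "size (mset_set (pverts G)) = n" by (metis size_image_mset size_replicate_mset)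
    moreover have "deg (parcs G) v = 2" if "v \<in> pverts G" for v
    proof -
      have "deg (parcs G) v \<in># image_mset (deg (parcs G)) (mset_set (pverts G))"
        using that \<open>finite (pverts G)\<close> by auto
      then show ?thesis unfolding eq by (auto split: if_splits)
    qed
    ultimately show "card (pverts G) = n \<and> (\<forall>v\<in>pverts G. deg (parcs G) v = 2)" by simp
  next
    assume R: "card (pverts G) = n \<and> (\<forall>v\<in>pverts G. deg (parcs G) v = 2)"
    then have "image_mset (deg (parcs G)) (mset_set (pverts G)) = image_mset (\<lambda>_. 2) (mset_set (pverts G))"
      using that by (intro image_mset_cong) simp
    then show "degree_seq G = degree_seq ?C" using R by (simp add: degree_seq_eq_iff C image_mset_const_eq)
  qed
  have "degree_seq ?C \<preceq>\<^sub>d D \<longleftrightarrow>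
    (\<exists>G W. realization G D \<and> W \<subseteq> pverts G \<and> card W = n \<and> two_regular (parcs G) W)" (is "?L \<longleftrightarrow> ?R")
  proof
    assume ?L
    then obtain G1 G :: "nat pair_pre_digraph" where G1: "pair_graph G1" "degree_seq G1 = degree_seq ?C"
      and G: "realization G D" and emb: "G1 \<sqsubseteq>\<^sub>g G"
      unfolding seq_embeds_def realization_def by blast
    have fin: "finite (pverts G1)" and g1: "parcs G1 \<subseteq> pverts G1 \<times> pverts G1"
      using G1(1) by (auto simp: pair_graph_iff)
    have reg: "card (pverts G1) = n" "\<And>v. v \<in> pverts G1 \<Longrightarrow> deg (parcs G1) v = 2"
      using seq[OF fin] G1(2) by auto
    obtain f where f: "inj_on f (pverts G1)" "f ` pverts G1 \<subseteq> pverts G"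
      "\<And>u v. u \<in> pverts G1 \<Longrightarrow> v \<in> pverts G1 \<Longrightarrow> (f u, f v) \<in> parcs G \<longleftrightarrow> (u, v) \<in> parcs G1"
      using emb embeds_iff[OF G1(1), of G] G unfolding realization_def by blast
    have bij: "bij_betw f (pverts G1) (f ` pverts G1)" using f(1) by (simp add: bij_betw_def)
    have "deg (Restr (parcs G) (f ` pverts G1)) (f u) = deg (parcs G1) u" if "u \<in> pverts G1" for u
      by (rule deg_iso[OF bij]) (use f(3) that g1 in auto)
    then have "two_regular (parcs G) (f ` pverts G1)" using reg by (auto simp: two_regular_def)
    moreover have "card (f ` pverts G1) = n" using f(1) reg by (simp add: card_image)
    ultimately show ?R using f(2) G by blast
  next
    assume ?R
    then obtain G W where G: "realization G D" and W: "W \<subseteq> pverts G" "card W = n"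
      and reg: "two_regular (parcs G) W" by blast
    \<comment> \<open>The subgraph induced on \<open>W\<close> realizes the degree sequence of the
      cycle even if it is disconnected.\<close>
    define H where "H = \<lparr>pverts = W, parcs = Restr (parcs G) W\<rparr>"
    have PG: "pair_graph G" using G by (simp add: realization_def)
    then have H: "pair_graph H"
      using W by (auto simp: H_def pair_graph_iff sym_def irrefl_def finite_subset)
    moreover have "degree_seq H = degree_seq ?C"
      using seq[of H] H W(2) reg by (simp add: H_def pair_graph_iff two_regular_def)
    moreover have "H \<sqsubseteq>\<^sub>g G"
      unfolding embeds_iff[OF H PG] using W(1) by (intro exI[of _ id]) (auto simp: H_def)
    ultimately show ?L using G unfolding seq_embeds_def realization_def by blast
  qed
  then show ?thesis unfolding excludes_def by blast
qed

text \<open>The edges inside \<open>X\<close> are exchanged for an \<open>n\<close>-cycle on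
  \<open>W\<close> together with \<open>T\<close>. Since \<open>T\<close> has no arc inside
  \<open>W\<close>, the planted cycle is induced, against the exclusion.\<close>

lemma excludes_cycle_replace:
  assumes n: "n \<ge> 3" and exc: "excludes D (cycle_graph n)" and G: "realization G D"
    and X: "X \<subseteq> pverts G" "W \<subseteq> X" "card W = n"
    and T: "graph_on T X" "T \<inter> W \<times> W = {}"
    and deg: "\<And>x. x \<in> X \<Longrightarrow> deg (Restr (parcs G) X) x = deg T x + (if x \<in> W then 2 else 0)"
  shows False
proof -
  have fin: "finite X" "finite W"
    using G X by (auto simp: realization_def pair_graph_iff intro: finite_subset)
  obtain F h where F: "graph_on F W" "\<And>w. w \<in> W \<Longrightarrow> deg F w = 2"
    using cycle_graph_on[OF fin(2) X(3) n] by metis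
  have "deg (F \<union> T) x = deg (Restr (parcs G) X) x" if "x \<in> X" for x
  proof -
    have "deg (F \<union> T) x = deg F x + deg T x"
      by (rule deg_Un) (use F T fin graph_on_finite in \<open>auto simp: graph_on_def\<close>)
    moreover have "deg F x = (if x \<in> W then 2 else 0)"
      using F deg_outside unfolding graph_on_def by metis
    ultimately show ?thesis using deg that by simp
  qed
  then obtain G' where G': "realization G' D" "pverts G' = pverts G" "Restr (parcs G') X = F \<union> T"
    using replace_induced[OF G X(1), of "F \<union> T"] F T X(2) by (metis graph_on_Un graph_on_mono)
  have "Restr (parcs G') W = Restr (Restr (parcs G') X) W" using X(2) by auto
  also have "\<dots> = F" unfolding G'(3) using F(1) T(2) by (auto simp: graph_on_def)
  finally have "two_regular (parcs G') W" using F(2) by (simp add: two_regular_def)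
  then show False using exc[unfolded excludes_cycle_iff[OF n]] G'(1,2) X by blast
qed

subsection \<open>Realizations with an induced cycle longer than the excluded one\<close>

text \<open>For \<open>C\<close> 2-regularity suffices, because each rewiring discards all edges
  inside \<open>C\<close> at once.\<close>

locale missing_cycle =
  fixes n :: nat and D :: "nat list" and G :: "nat pair_pre_digraph" and C :: "nat set"
  assumes n: "n \<ge> 3" and exc: "excludes D (cycle_graph n)" and G: "realization G D"
    and C: "C \<subseteq> pverts G" "two_regular (parcs G) C" "card C > n"
begin

lemma graph_on_arcs: "graph_on (parcs G) (pverts G)" and finite_verts: "finite (pverts G)"
  using G by (auto simp: realization_def pair_graph_iff_graph_on)

lemma finite_C: "finite C"
  using C finite_verts finite_subset by blast

lemma edge_sym: "(u, v) \<in> parcs G \<Longrightarrow> (v, u) \<in> parcs G"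
  and edge_irrefl: "(u, u) \<notin> parcs G"
  using graph_on_arcs by (auto simp: graph_on_def sym_def irrefl_def)

lemma finite_Restr: "finite (Restr (parcs G) X)"
  using graph_on_finite[OF graph_on_arcs finite_verts] by simp

lemma deg_Restr_C: "deg (Restr (parcs G) C) u = (if u \<in> C then 2 else 0)"
  using C(2) deg_outside[of "Restr (parcs G) C" C C u] by (auto simp: two_regular_def)

text \<open>
  The rewirings below put an \<open>n\<close>-cycle on \<open>W \<subseteq> C\<close>; \<open>R\<close> and \<open>T\<close> are the edges of \<open>Y \<union> C\<close> outside \<open>C\<close>
  before, and outside the new cycle after the rewiring.
\<close>

lemma no_rewiring:
  assumes "finite Y" "Y \<inter> C = {}" "Y \<subseteq> pverts G" "W \<subseteq> C" "card W = n"
    and "Restr (parcs G) (Y \<union> C) = Restr (parcs G) C \<union> R" "Restr (parcs G) C \<inter> R = {}"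
    and "graph_on T (Y \<union> C)" "T \<inter> W \<times> W = {}"
    and "\<And>x. x \<in> W \<Longrightarrow> deg T x = deg R x"
    and "\<And>x. x \<in> C - W \<Longrightarrow> deg T x = deg R x + 2"
    and "\<And>x. x \<in> Y \<Longrightarrow> deg T x = deg R x"
  shows False
proof (rule excludes_cycle_replace[OF n exc G, of "Y \<union> C" W T])
  fix x assume x: "x \<in> Y \<union> C"
  have "finite R" using finite_Restr[of "Y \<union> C"] assms(6) by (metis finite_Un)
  \<comment> \<open>Each vertex of \<open>C\<close> loses its two edges inside \<open>C\<close>. On
    \<open>W\<close> the planted cycle gives them back; on \<open>C - W\<close> it is
    \<open>T\<close> that has to supply the extra 2.\<close>
  then have "deg (Restr (parcs G) (Y \<union> C)) x = (if x \<in> C then 2 else 0) + deg R x"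
    unfolding assms(6) using deg_Un[OF finite_Restr _ assms(7)] deg_Restr_C by simp
  then show "deg (Restr (parcs G) (Y \<union> C)) x = deg T x + (if x \<in> W then 2 else 0)"
    using x assms(2,4) assms(10-12)[of x] by (auto split: if_splits)
qed (use assms(1-5,8,9) C(1) in auto)

text \<open>Three or more leftover vertices carry a cycle of their own, so no vertex outside
  \<open>C\<close> is needed (\<open>Y = {}\<close>). One or two leftover vertices cannot be
  2-regular by themselves, which is why the next lemmas draw on outside vertices.\<close>

lemma card_C: "card C = n + 1 \<or> card C = n + 2"
proof (rule ccontr)
  assume "\<not> ?thesis"
  then have "card C \<ge> n + 3" using C(3) by simp
  then obtain W where W: "W \<subseteq> C" "card W = n" using obtain_subset_with_card_n[of n C] by auto
  have fW: "finite W" using W finite_C finite_subset by blast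
  have "card (C - W) \<ge> 3" using W \<open>card C \<ge> n + 3\<close> finite_C fW by (simp add: card_Diff_subset)
  then obtain T h where T: "graph_on T (C - W)" "\<And>w. w \<in> C - W \<Longrightarrow> deg T w = 2"
    using cycle_graph_on[of "C - W" "card (C - W)"] finite_C by (metis finite_Diff)
  have "deg T w = 0" if "w \<in> W" for w
    using T(1) deg_outside[of T "C - W" "C - W" w] that by (auto simp: graph_on_def)
  then show False
    using T W by (intro no_rewiring[of "{}" W "{}" T]) (auto simp: deg_empty graph_on_def)
qed

section \<open>Rewirings that use one or two vertices outside \<open>C\<close>\<close>

lemma removed_set:
  assumes "Z \<subseteq> C" "card Z = card C - n"
  shows "C - Z \<subseteq> C" "card (C - Z) = n"
  using assms C(3) finite_C by (auto simp: card_Diff_subset finite_subset)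

text \<open>The edge \<open>v p\<close> is replaced by a path from \<open>v\<close> to
  \<open>p\<close> through the one or two vertices taken out of \<open>C\<close>. The inner vertices
  gain the missing degree 2, while \<open>v\<close> and \<open>p\<close> keep their degrees. The
  first inner vertex is \<open>y\<close>, which is not yet joined to \<open>v\<close>.\<close>

lemma all_or_none:
  assumes v: "v \<in> pverts G - C" and p: "p \<in> C" "(v, p) \<in> parcs G" and y: "y \<in> C" "(v, y) \<notin> parcs G"
  shows False
proof -
  define N where "N = {u \<in> C. (v, u) \<in> parcs G}"
  have N: "finite N" "v \<notin> N" "p \<in> N" "y \<notin> N" "N \<subseteq> C"
    using v p y finite_C by (auto simp: N_def)
  have vC: "v \<notin> C" "v \<noteq> y" "v \<noteq> p" "p \<noteq> y" using v p y by auto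
  have vsym: "(u, v) \<in> parcs G \<longleftrightarrow> (v, u) \<in> parcs G" for u using edge_sym by blast
  have R: "Restr (parcs G) ({v} \<union> C) = Restr (parcs G) C \<union> star v N" "Restr (parcs G) C \<inter> star v N = {}"
    using vC edge_irrefl vsym by (auto simp: star_def N_def)
  \<comment> \<open>When two vertices have to be taken out, the choice of the second depends on
    whether \<open>v\<close> has another non-neighbour in \<open>C\<close>.\<close>
  consider "card C = n + 1" | z where "card C = n + 2" "z \<in> C" "z \<notin> N" "z \<noteq> y"
    | "card C = n + 2" "N = C - {y}"
  proof (cases "N = C - {y}")
    case True
    then show ?thesis using card_C that(1,3) by argo
  next
    case False
    then obtain z where "z \<in> C" "z \<notin> N" "z \<noteq> y" using N by blast
    then show ?thesis using card_C that(1) that(2)[of z] by argo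
  qed
  then show False
  proof cases
    case 1
    have W: "C - {y} \<subseteq> C" "card (C - {y}) = n" using removed_set[of "{y}"] 1 y by auto
    \<comment> \<open>The path \<open>v, y, p\<close> in place of the edge
      \<open>v p\<close>.\<close>
    let ?T = "star v (insert y (N - {p})) \<union> star y {p}"
    have d: "deg ?T u = deg (star v (insert y (N - {p}))) u + deg (star y {p}) u" for u
      by (rule deg_Un) (use N vC in \<open>simp_all add: finite_star star_disjoint Int_Un_distrib2\<close>)
    have c: "card (insert y (N - {p})) = card N" using N card.remove[of N p] by simp
    show False
    proof (rule no_rewiring[of "{v}" "C - {y}" "star v N" ?T])
      show "graph_on ?T ({v} \<union> C)"
        by (intro graph_on_Un graph_on_star) (use vC N y p v in auto)
      show "?T \<inter> (C - {y}) \<times> (C - {y}) = {}" using vC by (auto simp: star_def)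
    next
      fix x
      { assume "x \<in> C - {y}" then show "deg ?T x = deg (star v N) x"
        unfolding d using vC N y p v by (auto simp: deg_star) }
      { assume "x \<in> C - (C - {y})" then show "deg ?T x = deg (star v N) x + 2"
        unfolding d using vC N y p v by (auto simp: deg_star) }
      { assume "x \<in> {v}" then show "deg ?T x = deg (star v N) x"
        unfolding d using vC N y p v c by (auto simp: deg_star) }
    qed (rule R W | simp add: v[simplified])+
  next
    case 2
    have W: "C - {y, z} \<subseteq> C" "card (C - {y, z}) = n" using removed_set[of "{y, z}"] 2 y by auto
    \<comment> \<open>The path \<open>v, y, z, p\<close> in place of the edge
      \<open>v p\<close>.\<close>
    let ?T1 = "star v (insert y (N - {p}))" and ?T2 = "star y {z}" and ?T3 = "star z {p}"
    let ?T = "?T1 \<union> ?T2 \<union> ?T3"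
    have z: "z \<noteq> v" "z \<noteq> p" using 2 N vC by auto
    have "deg ?T u = deg (?T1 \<union> ?T2) u + deg ?T3 u" for u
      by (rule deg_Un) (use N vC z 2 in \<open>simp_all add: finite_star star_disjoint Int_Un_distrib2\<close>)
    moreover have "deg (?T1 \<union> ?T2) u = deg ?T1 u + deg ?T2 u" for u
      by (rule deg_Un) (use N vC z 2 in \<open>simp_all add: finite_star star_disjoint Int_Un_distrib2\<close>)
    ultimately have d: "deg ?T u = deg ?T1 u + deg ?T2 u + deg ?T3 u" for u by simp
    have c: "card (insert y (N - {p})) = card N" using N card.remove[of N p] by simp
    show False
    proof (rule no_rewiring[of "{v}" "C - {y, z}" "star v N" ?T])
      show "graph_on ?T ({v} \<union> C)"
        by (intro graph_on_Un graph_on_star) (use vC N y p v z 2 in auto)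
      show "?T \<inter> (C - {y, z}) \<times> (C - {y, z}) = {}" using vC by (auto simp: star_def)
    next
      fix x
      { assume "x \<in> C - {y, z}" then show "deg ?T x = deg (star v N) x"
        unfolding d using vC N y p v z 2 by (auto simp: deg_star) }
      { assume "x \<in> C - (C - {y, z})" then show "deg ?T x = deg (star v N) x + 2"
        unfolding d using vC N y p v z 2 by (auto simp: deg_star) }
      { assume "x \<in> {v}" then show "deg ?T x = deg (star v N) x"
        unfolding d using vC N y p v z 2 c by (auto simp: deg_star) }
    qed (rule R W | simp add: v[simplified])+
  next
    case 3
    \<comment> \<open>With no second non-neighbour, a further neighbour \<open>q\<close> of
      \<open>v\<close> becomes the second inner vertex: the path is \<open>v, y, q, p\<close>, and
      the edge \<open>v q\<close> stays.\<close>
    have "card N = n + 1" using 3 y finite_C by simp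
    then have "card (N - {p}) > 0" using N n by simp
    then obtain q where q: "q \<in> N" "q \<noteq> p" by (metis Diff_iff card_gt_0_iff ex_in_conv singletonI)
    have W: "C - {y, q} \<subseteq> C" "card (C - {y, q}) = n" using removed_set[of "{y, q}"] 3 y q N by auto
    let ?T1 = "star v (insert y (N - {p}))" and ?T2 = "star q {y, p}"
    let ?T = "?T1 \<union> ?T2"
    have z: "q \<noteq> v" "q \<noteq> y" using q N vC by auto
    have d: "deg ?T u = deg ?T1 u + deg ?T2 u" for u
      by (rule deg_Un) (use N vC z q in \<open>simp_all add: finite_star star_disjoint Int_Un_distrib2\<close>)
    have c: "card (insert y (N - {p})) = card N" using N card.remove[of N p] by simp
    show False
    proof (rule no_rewiring[of "{v}" "C - {y, q}" "star v N" ?T])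
      show "graph_on ?T ({v} \<union> C)"
        by (intro graph_on_Un graph_on_star) (use vC N y p v z q 3 in auto)
      show "?T \<inter> (C - {y, q}) \<times> (C - {y, q}) = {}" using vC by (auto simp: star_def)
    next
      fix x
      { assume "x \<in> C - {y, q}" then show "deg ?T x = deg (star v N) x"
        unfolding d using vC N y p v z q 3 by (auto simp: deg_star) }
      { assume "x \<in> C - (C - {y, q})" then show "deg ?T x = deg (star v N) x + 2"
        unfolding d using vC N y p v z q 3 by (auto simp: deg_star) }
      { assume "x \<in> {v}" then show "deg ?T x = deg (star v N) x"
        unfolding d using vC N y p v z q 3 c by (auto simp: deg_star) }
    qed (rule R W | simp add: v[simplified])+
  qed
qed

text \<open>The edges \<open>v c\<close> and \<open>w d\<close> are given up for the new edge
  \<open>v w\<close>, which leaves \<open>c\<close> and \<open>d\<close> one short each. A path from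
  \<open>c\<close> to \<open>d\<close> through the vertices of \<open>C - W\<close> makes up for
  this and supplies the missing degree 2 to its inner vertices.\<close>

lemma complete_outside:
  assumes vw: "v \<in> pverts G - C" "w \<in> pverts G - C" "v \<noteq> w" "(v, w) \<notin> parcs G"
    and vC: "\<And>u. u \<in> C \<Longrightarrow> (v, u) \<in> parcs G" and wC: "\<And>u. u \<in> C \<Longrightarrow> (w, u) \<in> parcs G"
  shows False
proof -
  have vw': "v \<notin> C" "w \<notin> C" "w \<noteq> v" using vw by auto
  have sym: "u \<in> C \<Longrightarrow> (u, v) \<in> parcs G" "u \<in> C \<Longrightarrow> (u, w) \<in> parcs G" "(w, v) \<notin> parcs G" for u
    using edge_sym vw(4) vC wC by blast+
  let ?R = "star v C \<union> star w C"
  have R: "Restr (parcs G) ({v, w} \<union> C) = Restr (parcs G) C \<union> ?R" "Restr (parcs G) C \<inter> ?R = {}"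
    using vw(4) vw' edge_irrefl sym vC wC by (auto simp: star_def)
  have dR: "deg ?R u = deg (star v C) u + deg (star w C) u" for u
    by (rule deg_Un) (use finite_C vw vw' in \<open>simp_all add: finite_star star_disjoint Int_Un_distrib2\<close>)
  obtain W where W: "W \<subseteq> C" "card W = n" using obtain_subset_with_card_n[of n C] C(3) by auto
  have fW: "finite W" using W finite_C finite_subset by blast
  have "card W \<ge> 2" using W n by simp
  \<comment> \<open>Both lie in \<open>W\<close> and so differ from the inner vertices of the path;
    every path edge still has an end outside \<open>W\<close>.\<close>
  then obtain c d where cd: "c \<in> W" "d \<in> W" "c \<noteq> d"
    by (metis One_nat_def Suc_leD card_le_Suc0_iff_eq fW not_less_eq_eq numeral_2_eq_2)
  have cdC: "c \<in> C" "d \<in> C" "c \<noteq> v" "c \<noteq> w" "d \<noteq> v" "d \<noteq> w" using cd W vw' by auto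
  \<comment> \<open>Common to both cases: \<open>v\<close> trades \<open>c\<close> for
    \<open>w\<close>, and \<open>w\<close> trades \<open>d\<close> for \<open>v\<close>.\<close>
  let ?P = "star v (insert w (C - {c})) \<union> star w (C - {d})"
  have dP: "deg ?P u = deg (star v (insert w (C - {c}))) u + deg (star w (C - {d})) u" for u
    by (rule deg_Un) (use finite_C vw vw' in \<open>simp_all add: finite_star star_disjoint Int_Un_distrib2\<close>)
  have cards: "card (insert w (C - {c})) = card C" "Suc (card (C - {d})) = card C"
    using finite_C vw' cdC C(3) by (simp_all add: card_Suc_Diff1 del: card_Diff_insert card_Diff_singleton)
  have g0: "graph_on ?P ({v, w} \<union> C)"
    by (intro graph_on_Un graph_on_star) (use vw' in auto)
  have "card (C - W) = 1 \<or> card (C - W) = 2"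
    using card_C W fW by (auto simp: card_Diff_subset)
  then consider x where "C - W = {x}" | x y where "C - W = {x, y}" "x \<noteq> y"
    by (auto simp: card_1_singleton_iff card_2_iff)
  then show False
  proof cases
    case 1
    have x: "x \<in> C" "x \<notin> W" "x \<noteq> v" "x \<noteq> w" "x \<noteq> c" "x \<noteq> d" using 1 vw' cd by auto
    \<comment> \<open>The path \<open>c, x, d\<close>.\<close>
    let ?T = "?P \<union> star x {c, d}"
    have dT: "deg ?T u = deg ?P u + deg (star x {c, d}) u" for u
      by (rule deg_Un) (use finite_C x cdC in \<open>simp_all add: finite_star star_disjoint Int_Un_distrib2\<close>)
    show False
    proof (rule no_rewiring[of "{v, w}" W ?R ?T])
      show "graph_on ?T ({v, w} \<union> C)"
        by (intro graph_on_Un[OF g0] graph_on_star) (use x cdC in auto)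
      show "?T \<inter> W \<times> W = {}" using W(1) vw' x by (auto simp: star_def)
    next
      fix u
      {
        assume u: "u \<in> W"
        have "u \<in> C" "u \<noteq> v" "u \<noteq> w" "u \<noteq> x" using W(1) u vw' x by auto
        then show "deg ?T u = deg ?R u"
          unfolding dT dP dR using vw' x cdC cd by (simp add: deg_star)
      }
      {
        assume "u \<in> C - W"
        then have "u = x" using 1 by auto
        then show "deg ?T u = deg ?R u + 2"
          unfolding dT dP dR using vw' x cdC cd by (simp add: deg_star)
      }
      {
        assume "u \<in> {v, w}"
        then have "u = v \<or> u = w" by simp
        then show "deg ?T u = deg ?R u"
          unfolding dT dP dR using vw' x cdC cd cards by (elim disjE) (simp_all add: deg_star)
      }
    qed (rule R W | simp add: vw[simplified])+
  next
    case 2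
    have x: "x \<in> C" "x \<notin> W" "x \<noteq> v" "x \<noteq> w" "x \<noteq> c" "x \<noteq> d"
      and y: "y \<in> C" "y \<notin> W" "y \<noteq> v" "y \<noteq> w" "y \<noteq> c" "y \<noteq> d" "y \<noteq> x" using 2 vw' cd by auto
    \<comment> \<open>Together with \<open>?T\<close>, the path \<open>c, x, y, d\<close>.\<close>
    let ?Q = "?P \<union> star x {y, c}"
    let ?T = "?Q \<union> star y {d}"
    have dQ: "deg ?Q u = deg ?P u + deg (star x {y, c}) u" for u
      by (rule deg_Un) (use finite_C x y cdC in \<open>simp_all add: finite_star star_disjoint Int_Un_distrib2\<close>)
    have dT: "deg ?T u = deg ?Q u + deg (star y {d}) u" for u
      by (rule deg_Un) (use finite_C x y cd cdC in \<open>simp_all add: finite_star star_disjoint Int_Un_distrib2\<close>)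
    show False
    proof (rule no_rewiring[of "{v, w}" W ?R ?T])
      show "graph_on ?T ({v, w} \<union> C)"
        by (intro graph_on_Un[OF graph_on_Un[OF g0]] graph_on_star) (use x y cdC in auto)
      show "?T \<inter> W \<times> W = {}" using W(1) vw' x y by (auto simp: star_def)
    next
      fix u
      {
        assume u: "u \<in> W"
        have "u \<in> C" "u \<noteq> v" "u \<noteq> w" "u \<noteq> x" "u \<noteq> y" using W(1) u vw' x y by auto
        then show "deg ?T u = deg ?R u"
          unfolding dT dQ dP dR using vw' x y cdC cd by (simp add: deg_star)
      }
      {
        assume "u \<in> C - W"
        then have "u = x \<or> u = y" using 2 by auto
        then show "deg ?T u = deg ?R u + 2"
          unfolding dT dQ dP dR using vw' x y cdC cd by (elim disjE) (simp_all add: deg_star)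
      }
      {
        assume "u \<in> {v, w}"
        then have "u = v \<or> u = w" by simp
        then show "deg ?T u = deg ?R u"
          unfolding dT dQ dP dR using vw' x y cdC cd cards by (elim disjE) (simp_all add: deg_star)
      }
    qed (rule R W | simp add: vw[simplified])+
  qed
qed

text \<open>The edge \<open>v w\<close> is replaced by a path from \<open>v\<close> to
  \<open>w\<close> whose inner vertices are those of \<open>C - W\<close>; these had no edge to
  \<open>v\<close> or \<open>w\<close> before.\<close>

lemma anticomplete_outside:
  assumes vw: "v \<in> pverts G - C" "w \<in> pverts G - C" "(v, w) \<in> parcs G"
    and vC: "\<And>u. u \<in> C \<Longrightarrow> (v, u) \<notin> parcs G" and wC: "\<And>u. u \<in> C \<Longrightarrow> (w, u) \<notin> parcs G"
  shows False
proof -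
  have vw': "v \<notin> C" "w \<notin> C" "w \<noteq> v" using vw edge_irrefl by auto
  have sym: "u \<in> C \<Longrightarrow> (u, v) \<notin> parcs G" "u \<in> C \<Longrightarrow> (u, w) \<notin> parcs G" "(w, v) \<in> parcs G" for u
    using edge_sym vw(3) vC wC by blast+
  let ?R = "star v {w}"
  have R: "Restr (parcs G) ({v, w} \<union> C) = Restr (parcs G) C \<union> ?R" "Restr (parcs G) C \<inter> ?R = {}"
    using vw(3) vw' edge_irrefl sym vC wC by (auto simp: star_def)
  obtain W where W: "W \<subseteq> C" "card W = n" using obtain_subset_with_card_n[of n C] C(3) by auto
  have fW: "finite W" using W finite_C finite_subset by blast
  have "card (C - W) = 1 \<or> card (C - W) = 2"
    using card_C W fW by (auto simp: card_Diff_subset)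
  then consider x where "C - W = {x}" | x y where "C - W = {x, y}" "x \<noteq> y"
    by (auto simp: card_1_singleton_iff card_2_iff)
  then show False
  proof cases
    case 1
    have x: "x \<in> C" "x \<notin> W" "x \<noteq> v" "x \<noteq> w" using 1 vw' by auto
    let ?T = "star x {v, w}"
    show False
    proof (rule no_rewiring[of "{v, w}" W ?R ?T])
      show "graph_on ?T ({v, w} \<union> C)"
        by (intro graph_on_star) (use x in auto)
      show "?T \<inter> W \<times> W = {}" using x by (auto simp: star_def)
    next
      fix u
      {
        assume u: "u \<in> W"
        have "u \<in> C" "u \<noteq> v" "u \<noteq> w" "u \<noteq> x" using W(1) u vw' x by auto
        then show "deg ?T u = deg ?R u"
          using vw' x by (simp add: deg_star)
      }
      {
        assume "u \<in> C - W"
        then have "u = x" using 1 by auto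
        then show "deg ?T u = deg ?R u + 2"
          using vw' x by (simp add: deg_star)
      }
      {
        assume "u \<in> {v, w}"
        then have "u = v \<or> u = w" by simp
        then show "deg ?T u = deg ?R u"
          using vw' x  by (elim disjE) (simp_all add: deg_star)
      }
    qed (rule R W | simp add: vw[simplified])+
  next
    case 2
    have x: "x \<in> C" "x \<notin> W" "x \<noteq> v" "x \<noteq> w"
      and y: "y \<in> C" "y \<notin> W" "y \<noteq> v" "y \<noteq> w" "y \<noteq> x" using 2 vw' by auto
    \<comment> \<open>The path \<open>v, x, y, w\<close>.\<close>
    let ?T = "star x {v, y} \<union> star y {w}"
    have dT: "deg ?T u = deg (star x {v, y}) u + deg (star y {w}) u" for u
      by (rule deg_Un) (use x y in \<open>simp_all add: finite_star star_disjoint Int_Un_distrib2\<close>)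
    show False
    proof (rule no_rewiring[of "{v, w}" W ?R ?T])
      show "graph_on ?T ({v, w} \<union> C)"
        by (intro graph_on_Un graph_on_star) (use x y in auto)
      show "?T \<inter> W \<times> W = {}" using x y by (auto simp: star_def)
    next
      fix u
      {
        assume u: "u \<in> W"
        have "u \<in> C" "u \<noteq> v" "u \<noteq> w" "u \<noteq> x" "u \<noteq> y" using W(1) u vw' x y by auto
        then show "deg ?T u = deg ?R u"
          unfolding dT using vw' x y by (simp add: deg_star)
      }
      {
        assume "u \<in> C - W"
        then have "u = x \<or> u = y" using 2 by auto
        then show "deg ?T u = deg ?R u + 2"
          unfolding dT using vw' x y by (elim disjE) (simp_all add: deg_star)
      }
      {
        assume "u \<in> {v, w}"
        then have "u = v \<or> u = w" by simp
        then show "deg ?T u = deg ?R u"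
          unfolding dT using vw' x y  by (elim disjE) (simp_all add: deg_star)
      }
    qed (rule R W | simp add: vw[simplified])+
  qed
qed

text \<open>\<open>A\<close> collects the vertices complete to \<open>C\<close>, and
  \<open>B\<close> the remaining outside vertices. The three rewirings in turn make \<open>B\<close>
  anticomplete to \<open>C\<close>, \<open>A\<close> complete and \<open>B\<close>
  anticomplete.\<close>

lemma decomposition:
  obtains A B where "pverts G = A \<union> B \<union> C" "decomposed (parcs G) A B C"
proof
  let ?A = "{v \<in> pverts G - C. \<forall>u\<in>C. (v, u) \<in> parcs G}"
  let ?B = "pverts G - C - ?A"
  show "pverts G = ?A \<union> ?B \<union> C" using C(1) by auto
  \<comment> \<open>A vertex of \<open>?B\<close> misses some vertex of \<open>C\<close>, so by
    \<open>all_or_none\<close> it misses all of them.\<close>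
  have B: "(v, u) \<notin> parcs G" if "v \<in> ?B" "u \<in> C" for u v
    using all_or_none that by blast
  show "decomposed (parcs G) ?A ?B C"
    unfolding decomposed_def
  proof (intro conjI)
    have "(v, w) \<in> parcs G" if "v \<in> ?A" "w \<in> ?A" "v \<noteq> w" for v w
      using complete_outside[of v w] that by auto
    then show "?A \<times> ?A - Id \<subseteq> parcs G" by blast
    have "(v, w) \<notin> parcs G" if "v \<in> ?B" "w \<in> ?B" for v w
      using anticomplete_outside[of v w] B that by blast
    then show "parcs G \<inter> ?B \<times> ?B = {}" by blast
    show "parcs G \<inter> ?B \<times> C = {}" using B by blast
  qed auto
qed

end

subsection \<open>Degree sums of split compositions\<close>

lemma sum_deg:
  assumes "graph_on R V" "finite V" "X \<subseteq> V"
  shows "(\<Sum>x\<in>X. deg R x) = card (R \<inter> X \<times> V)"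
proof -
  have "R \<inter> X \<times> V = Sigma X (\<lambda>x. R `` {x})" using assms(1) by (auto simp: graph_on_def)
  moreover have "finite (R `` {x})" for x using graph_on_finite[OF assms(1,2)] by (simp add: finite_Image)
  ultimately show ?thesis
    using assms(2,3) by (simp add: deg_def card_SigmaI finite_subset)
qed

lemma card_sym_Times:
  assumes "sym R"
  shows "card (R \<inter> X \<times> Y) = card (R \<inter> Y \<times> X)"
proof -
  have "R \<inter> Y \<times> X = (R \<inter> X \<times> Y)\<inverse>" using assms by (auto simp: sym_def)
  then show ?thesis by simp
qed

text \<open>Sort the arcs leaving \<open>A\<close> and those leaving \<open>B\<close> by the part in
  which they end. By symmetry as many arcs go from \<open>A\<close> to \<open>B\<close> as from
  \<open>B\<close> to \<open>A\<close>, so these cancel.\<close>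

lemma split_balance:
  assumes R: "graph_on R (A \<union> B \<union> H)" and fin: "finite (A \<union> B \<union> H)"
    and dis: "A \<inter> B = {}" "A \<inter> H = {}" "B \<inter> H = {}"
  shows "(\<Sum>x\<in>A. deg R x) + card (R \<inter> B \<times> B) + card (R \<inter> B \<times> H) =
    (\<Sum>x\<in>B. deg R x) + card (R \<inter> A \<times> A) + card (R \<inter> A \<times> H)"
proof -
  have fR: "finite R" using graph_on_finite[OF R fin] .
  have "(\<Sum>x\<in>X. deg R x) = card (R \<inter> X \<times> A) + card (R \<inter> X \<times> B) + card (R \<inter> X \<times> H)"
    if "X \<subseteq> A \<union> B \<union> H" for X
  proof -
    have "R \<inter> X \<times> (A \<union> B \<union> H) = (R \<inter> X \<times> A \<union> R \<inter> X \<times> B) \<union> R \<inter> X \<times> H" by auto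
    moreover have "card \<dots> = card (R \<inter> X \<times> A \<union> R \<inter> X \<times> B) + card (R \<inter> X \<times> H)"
      by (rule card_Un_disjoint) (use fR dis in auto)
    moreover have "card (R \<inter> X \<times> A \<union> R \<inter> X \<times> B) = card (R \<inter> X \<times> A) + card (R \<inter> X \<times> B)"
      by (rule card_Un_disjoint) (use fR dis in auto)
    ultimately show ?thesis using sum_deg[OF R fin that] by simp
  qed
  from this[of A] this[of B] have "(\<Sum>x\<in>A. deg R x) = card (R \<inter> A \<times> A) + card (R \<inter> A \<times> B) + card (R \<inter> A \<times> H)"
    "(\<Sum>x\<in>B. deg R x) = card (R \<inter> B \<times> A) + card (R \<inter> B \<times> B) + card (R \<inter> B \<times> H)"
    by auto
  then show ?thesis using card_sym_Times[of R A B] R by (simp add: graph_on_def)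
qed


text \<open>In \<open>split_balance\<close> the arcs inside \<open>A\<close> and from
  \<open>A\<close> to \<open>H\<close> are bounded above by the two products, and the arcs inside
  \<open>B\<close> and from \<open>B\<close> to \<open>H\<close> are bounded below by 0; the
  equation holds iff all four bounds are attained. It mentions only degrees and cardinalities, so it
  passes to other realizations. With \<open>H = {}\<close> it is the Hammer-Simeone criterion for
  split graphs.\<close>

lemma decomposed_iff_sum_deg:
  assumes R: "graph_on R (A \<union> B \<union> H)" and fin: "finite (A \<union> B \<union> H)"
    and dis: "A \<inter> B = {}" "A \<inter> H = {}" "B \<inter> H = {}"
  shows "decomposed R A B H \<longleftrightarrow>
    (\<Sum>x\<in>A. deg R x) = (\<Sum>x\<in>B. deg R x) + card A * (card A - 1) + card A * card H"
proof -
  have fR: "finite R" using graph_on_finite[OF R fin] .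
  have f: "finite A" "finite B" "finite H" using fin by auto
  have AA: "A \<times> A - Id = Sigma A (\<lambda>a. A - {a})" by auto
  have cAA: "card (A \<times> A - Id) = card A * (card A - 1)"
    unfolding AA using f by (simp add: card_SigmaI)
  have sub: "R \<inter> A \<times> A \<subseteq> A \<times> A - Id" using R by (auto simp: graph_on_def irrefl_def)
  have le: "card (R \<inter> A \<times> A) \<le> card A * (card A - 1)" "card (R \<inter> A \<times> H) \<le> card A * card H"
    using card_mono[OF _ sub] cAA card_mono[of "A \<times> H" "R \<inter> A \<times> H"] f
    by (auto simp: card_cartesian_product)
  have "A \<times> A - Id \<subseteq> R \<longleftrightarrow> card (R \<inter> A \<times> A) = card A * (card A - 1)"
  proof
    assume "A \<times> A - Id \<subseteq> R"
    then have "R \<inter> A \<times> A = A \<times> A - Id" using sub by blast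
    then show "card (R \<inter> A \<times> A) = card A * (card A - 1)" using cAA by simp
  next
    assume "card (R \<inter> A \<times> A) = card A * (card A - 1)"
    then have "R \<inter> A \<times> A = A \<times> A - Id" using card_subset_eq[OF _ sub] f cAA by simp
    then show "A \<times> A - Id \<subseteq> R" by blast
  qed
  moreover have "A \<times> H \<subseteq> R \<longleftrightarrow> card (R \<inter> A \<times> H) = card A * card H"
  proof
    assume "A \<times> H \<subseteq> R"
    then have "R \<inter> A \<times> H = A \<times> H" by blast
    then show "card (R \<inter> A \<times> H) = card A * card H" by (simp add: card_cartesian_product)
  next
    assume "card (R \<inter> A \<times> H) = card A * card H"
    then have "R \<inter> A \<times> H = A \<times> H"
      using f by (intro card_subset_eq) (auto simp: card_cartesian_product)
    then show "A \<times> H \<subseteq> R" by blast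
  qed
  moreover have "R \<inter> B \<times> B = {} \<longleftrightarrow> card (R \<inter> B \<times> B) = 0" "R \<inter> B \<times> H = {} \<longleftrightarrow> card (R \<inter> B \<times> H) = 0"
    using fR by simp_all
  ultimately show ?thesis
    using split_balance[OF R fin dis] le dis unfolding decomposed_def by linarith
qed

section \<open>Induced 2-regular subgraphs of decomposed graphs\<close>

lemma decomposed_deg:
  assumes "decomposed R A B H" "graph_on R (A \<union> B \<union> H)" "finite (A \<union> B \<union> H)" "h \<in> H"
  shows "deg R h = card A + deg (Restr R H) h"
proof -
  have "R `` {h} = A \<union> Restr R H `` {h}"
    using assms(1,2,4) unfolding decomposed_def graph_on_def sym_def by blast
  moreover have "A \<inter> Restr R H `` {h} = {}" using assms(1) by (auto simp: decomposed_def)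
  moreover have "finite A" "finite (Restr R H `` {h})"
    using assms(3) graph_on_finite[OF assms(2,3)] by (auto simp: finite_Image)
  ultimately show ?thesis by (simp add: deg_def card_Un_disjoint)
qed

text \<open>The decomposition restricts to \<open>W\<close>. With all degrees equal to 2, the
  degree-sum equation becomes \<open>2 * a = 2 * b + a * (a - 1) + a * h\<close>, where
  \<open>a\<close>, \<open>b\<close>, \<open>h\<close> count the vertices of \<open>W\<close> in
  \<open>A\<close>, \<open>B\<close>, \<open>H\<close>; this has few solutions.\<close>

lemma two_regular_in_decomposed:
  assumes dec: "decomposed R A B H" and R: "graph_on R (A \<union> B \<union> H)" and fin: "finite (A \<union> B \<union> H)"
    and W: "W \<subseteq> A \<union> B \<union> H" "two_regular R W" "card W \<ge> 4"
  shows "W \<subseteq> H"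
proof -
  let ?A = "A \<inter> W" and ?B = "B \<inter> W" and ?H = "H \<inter> W" and ?R = "Restr R W"
  have dis: "A \<inter> B = {}" "A \<inter> H = {}" "B \<inter> H = {}" using dec by (auto simp: decomposed_def)
  have WU: "?A \<union> ?B \<union> ?H = W" using W(1) by auto
  have fW: "finite W" using W(1) fin finite_subset by blast
  have RW: "graph_on ?R W" using R by (auto simp: graph_on_def sym_def irrefl_def)
  have "decomposed ?R ?A ?B ?H" using dec unfolding decomposed_def by blast
  then have "(\<Sum>x\<in>?A. deg ?R x) = (\<Sum>x\<in>?B. deg ?R x) + card ?A * (card ?A - 1) + card ?A * card ?H"
    using decomposed_iff_sum_deg[of ?R ?A ?B ?H] RW fW dis unfolding WU by blast
  moreover have "(\<Sum>x\<in>X. deg ?R x) = 2 * card X" if "X \<subseteq> W" for X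
    using W(2) that by (simp add: two_regular_def subset_iff)
  ultimately have eq: "2 * card ?A = 2 * card ?B + card ?A * (card ?A - 1) + card ?A * card ?H" by simp
  have "card W = card (?A \<union> ?B) + card ?H"
    using WU card_Un_disjoint[of "?A \<union> ?B" ?H] dis fW by auto
  then have sum: "card ?A + card ?B + card ?H \<ge> 4"
    using W(3) card_Un_disjoint[of ?A ?B] dis fW by fastforce
  have "card ?A * (card ?A - 1 + card ?H) \<le> card ?A * 2" using eq by (simp add: algebra_simps)
  then have "card ?A = 0 \<or> card ?A - 1 + card ?H \<le> 2" by (metis mult_le_cancel1 gr0I)
  \<comment> \<open>If \<open>card ?A > 0\<close>, the equation leaves at most three vertices in
    \<open>W\<close>; triangles can indeed meet \<open>A\<close>, hence the bound 4. If
    \<open>card ?A = 0\<close>, it gives \<open>card ?B = 0\<close>.\<close>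
  then consider "card ?A = 0" | "card ?A = 1" "card ?H \<le> 2" | "card ?A = 2" "card ?H \<le> 1" | "card ?A = 3" "card ?H = 0"
    by linarith
  then have "card ?A = 0 \<and> card ?B = 0"
    using eq sum by cases auto
  then show ?thesis using WU fW by auto
qed

text \<open>A vertex of \<open>W\<close> has both of its neighbours in \<open>H\<close> already
  inside \<open>W\<close>, so no arc joins \<open>W\<close> to \<open>H - W\<close>. Any vertex of
  \<open>H - W\<close> therefore has two neighbours there, which makes three vertices.\<close>

lemma two_regular_psubset_card:
  assumes R: "graph_on R V" and H: "finite H" "two_regular R H" and W: "W \<subset> H" "two_regular R W"
  shows "card H \<ge> card W + 3"
proof -
  have finR: "finite (Restr R X `` {u})" if "finite X" for X u
    using that by (rule finite_subset[rotated]) auto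
  have fW: "finite W" using H(1) W(1) finite_subset by blast
  have eq: "Restr R W `` {w} = Restr R H `` {w}" if "w \<in> W" for w
    using that H W finR[OF H(1)] by (intro card_subset_eq) (auto simp: two_regular_def deg_def)
  obtain u where u: "u \<in> H" "u \<notin> W" using W(1) by blast
  have "Restr R H `` {u} \<subseteq> H - W - {u}"
  proof
    fix x assume "x \<in> Restr R H `` {u}"
    then have x: "(u, x) \<in> R" "x \<in> H" by auto
    then have "u \<in> Restr R H `` {x}" using R u by (auto simp: graph_on_def sym_def)
    then have "x \<notin> W" using eq u by auto
    then show "x \<in> H - W - {u}" using x R by (auto simp: graph_on_def irrefl_def)
  qed
  then have "card (Restr R H `` {u}) \<le> card (H - W - {u})" using H(1) by (intro card_mono) auto
  moreover have "card (Restr R H `` {u}) = 2" using H(2) u by (simp add: two_regular_def deg_def)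
  ultimately have "2 \<le> card (H - W) - 1" using u H(1) by simp
  then have "card (H - W) \<ge> 3" by simp
  then show ?thesis using card_Diff_subset[OF fW] W(1) by auto
qed

section \<open>From split compositions to exclusion, and from decomposed realizations back to split
  compositions\<close>

lemma decomposed_Un:
  assumes "A \<inter> B = {}" "(A \<union> B) \<inter> H = {}" "E \<subseteq> (A \<union> B) \<times> (A \<union> B)" "F \<subseteq> H \<times> H"
    and "A \<times> A - Id \<subseteq> E" "E \<inter> B \<times> B = {}"
  shows "decomposed (E \<union> F \<union> A \<times> H \<union> H \<times> A) A B H"
    and "Restr (E \<union> F \<union> A \<times> H \<union> H \<times> A) H = F"
proof -
  have E: "u \<in> A \<union> B \<and> v \<in> A \<union> B" if "(u, v) \<in> E" for u v using assms(3) that by auto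
  have F: "u \<in> H \<and> v \<in> H" if "(u, v) \<in> F" for u v using assms(4) that by auto
  have dis: "u \<notin> H" if "u \<in> A \<union> B" for u using assms(2) that by auto
  show "decomposed (E \<union> F \<union> A \<times> H \<union> H \<times> A) A B H"
    unfolding decomposed_def
  proof (intro conjI)
    show "A \<inter> B = {}" "A \<inter> H = {}" "B \<inter> H = {}" using assms(1,2) by auto
    show "A \<times> A - Id \<subseteq> E \<union> F \<union> A \<times> H \<union> H \<times> A" "A \<times> H \<subseteq> E \<union> F \<union> A \<times> H \<union> H \<times> A"
      using assms(5) by auto
    show "(E \<union> F \<union> A \<times> H \<union> H \<times> A) \<inter> B \<times> B = {}" using assms(6) F dis by blast
    show "(E \<union> F \<union> A \<times> H \<union> H \<times> A) \<inter> B \<times> H = {}" using assms(1) E F dis by blast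
  qed
  show "Restr (E \<union> F \<union> A \<times> H \<union> H \<times> A) H = F" using E F dis by auto
qed

text \<open>The degree-sum criterion carries the decomposition over to every realization. There a
  2-regular set of \<open>n\<close> vertices lies in the image of the cycle and would leave one or
  two vertices of it over, fewer than the three required.\<close>

lemma excludes_cycle_if_compose:
  assumes n: "n \<ge> 4" and S: "pair_graph S" "split_partition S A B" and m: "m = n + 1 \<or> m = n + 2"
    and dis: "pverts S \<inter> pverts (cycle_graph m) = {}"
  shows "excludes (degree_seq (split_compose S A B (cycle_graph m))) (cycle_graph n)"
proof -
  let ?K = "split_compose S A B (cycle_graph m)" and ?H = "pverts (cycle_graph m)"
  have m3: "m \<ge> 3" using n m by auto
  have C: "pair_graph (cycle_graph m)" "card ?H = m"
    using pair_graph_cycle_graph[OF m3] by (simp_all add: cycle_graph_def)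
  have arcs: "parcs S \<subseteq> pverts S \<times> pverts S" "parcs (cycle_graph m) \<subseteq> ?H \<times> ?H"
    using S(1) C(1) by (simp_all add: pair_graph_iff)
  have irr: "(x, x) \<notin> parcs S" for x using S(1) by (simp add: pair_graph_iff irrefl_def)
  have SAB: "pverts S = A \<union> B" "A \<inter> B = {}"
    and "complete_set S A" and "anticomplete_set S B"
    using S(2) by (simp_all add: split_partition_def)
  then have "A \<times> A - Id \<subseteq> parcs S" by (auto simp: complete_set_def)
  moreover have "(u, v) \<notin> parcs S" if "u \<in> B" "v \<in> B" for u v
    using \<open>anticomplete_set S B\<close> that irr by (cases "u = v") (simp_all add: anticomplete_set_def)
  then have "parcs S \<inter> B \<times> B = {}" by auto
  ultimately have dec: "decomposed (parcs ?K) A B ?H" and RH: "Restr (parcs ?K) ?H = parcs (cycle_graph m)"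
    using decomposed_Un[of A B ?H "parcs S" "parcs (cycle_graph m)"] SAB arcs dis
    by (simp_all add: split_compose_def)
  have "pair_graph ?K" using S C dis by (intro pair_graph_split_compose)
  moreover have V: "pverts ?K = A \<union> B \<union> ?H" by (simp add: split_compose_def SAB)
  ultimately have K: "graph_on (parcs ?K) (A \<union> B \<union> ?H)" "finite (A \<union> B \<union> ?H)"
    by (simp_all add: pair_graph_iff_graph_on)
  have disj: "A \<inter> B = {}" "A \<inter> ?H = {}" "B \<inter> ?H = {}" using dec by (auto simp: decomposed_def)
  have degH: "deg (parcs ?K) h = card A + 2" if "h \<in> ?H" for h
    using decomposed_deg[OF dec K that] RH deg_cycle_graph[OF m3, of h] that by (simp add: cycle_graph_def)
  show ?thesis
    unfolding excludes_cycle_iff[OF order.trans[OF _ n, of 3, simplified]]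
  proof (intro allI impI notI)
    fix G W assume G: "realization G (degree_seq ?K)" and W: "W \<subseteq> pverts G" "card W = n" "two_regular (parcs G) W"
    have GV: "graph_on (parcs G) (pverts G)" "finite (pverts G)"
      using G by (auto simp: realization_def pair_graph_iff_graph_on)
    have "degree_seq ?K = degree_seq G" using G by (simp add: realization_def)
    \<comment> \<open>\<open>h\<close> preserves degrees only; the adjacencies in \<open>G\<close>
      are recovered from the degree sums.\<close>
    then obtain h where h: "bij_betw h (A \<union> B \<union> ?H) (pverts G)"
      and degh: "\<And>x. x \<in> A \<union> B \<union> ?H \<Longrightarrow> deg (parcs G) (h x) = deg (parcs ?K) x"
      using image_mset_eq_bij[of "A \<union> B \<union> ?H" "pverts G" "deg (parcs ?K)" "deg (parcs G)"] K(2) GV(2)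
      unfolding degree_seq_eq_iff V by blast
    have inj: "inj_on h (A \<union> B \<union> ?H)" and VG: "pverts G = h ` A \<union> h ` B \<union> h ` ?H"
      using h by (auto simp: bij_betw_def)
    have injs: "inj_on h A" "inj_on h B" "inj_on h ?H" using inj by (auto intro: inj_on_subset)
    have "h ` X \<inter> h ` Y = {}" if "X \<inter> Y = {}" "X \<subseteq> A \<union> B \<union> ?H" "Y \<subseteq> A \<union> B \<union> ?H" for X Y
      using inj_on_image_Int[OF inj that(2,3)] that(1) by simp
    then have hdis: "h ` A \<inter> h ` B = {}" "h ` A \<inter> h ` ?H = {}" "h ` B \<inter> h ` ?H = {}"
      using disj by (meson Un_upper1 Un_upper2 le_supI1)+
    have "(\<Sum>x\<in>h ` A. deg (parcs G) x) = (\<Sum>x\<in>A. deg (parcs ?K) x)"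
      "(\<Sum>x\<in>h ` B. deg (parcs G) x) = (\<Sum>x\<in>B. deg (parcs ?K) x)"
      using degh by (simp_all add: sum.reindex[OF injs(1)] sum.reindex[OF injs(2)])
    moreover have "card (h ` A) = card A" "card (h ` ?H) = card ?H"
      using injs by (simp_all add: card_image)
    ultimately have decG: "decomposed (parcs G) (h ` A) (h ` B) (h ` ?H)"
      using dec decomposed_iff_sum_deg[OF K disj]
        decomposed_iff_sum_deg[of "parcs G" "h ` A" "h ` B" "h ` ?H"] GV hdis
      unfolding VG by simp
    \<comment> \<open>Of the degree \<open>card A + 2\<close> exactly \<open>card A\<close> goes to
      the image of \<open>A\<close>. The 2-regular remainder need not be a single cycle.\<close>
    have reg: "two_regular (parcs G) (h ` ?H)"
      unfolding two_regular_def
    proof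
      fix w assume w: "w \<in> h ` ?H"
      then have "deg (parcs G) w = card A + 2" using degh degH by auto
      then show "deg (Restr (parcs G) (h ` ?H)) w = 2"
        using decomposed_deg[OF decG _ _ w] GV \<open>card (h ` A) = card A\<close> unfolding VG by simp
    qed
    have "W \<subseteq> h ` ?H"
      using two_regular_in_decomposed[OF decG] GV W n unfolding VG by auto
    moreover have "card (h ` ?H) = m" using C \<open>card (h ` ?H) = card ?H\<close> by simp
    ultimately have "W \<subset> h ` ?H" using m W(2) by auto
    moreover have "finite (h ` ?H)" using K(2) by simp
    ultimately have "card (h ` ?H) \<ge> card W + 3"
      using two_regular_psubset_card[OF GV(1) _ reg _ W(3)] by blast
    then show False using W(2) m \<open>card (h ` ?H) = m\<close> by auto
  qed
qed

text \<open>An induced 2-regular subgraph on \<open>n\<close> vertices may be disconnected, but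
  exchanging it for an \<open>n\<close>-cycle gives a realization with an induced cycle.\<close>

lemma excludes_cycle_if_forcibly:
  assumes n: "n \<ge> 3" and forc: "forcibly (\<lambda>G. \<forall>m\<ge>n. \<not> cycle_graph m \<sqsubseteq>\<^sub>g G) D"
  shows "excludes D (cycle_graph n)"
  unfolding excludes_cycle_iff[OF n]
proof (intro allI impI notI)
  fix G W assume G: "realization G D" and W: "W \<subseteq> pverts G" "card W = n" "two_regular (parcs G) W"
  have "finite W" using G W finite_subset by (auto simp: realization_def pair_graph_iff)
  from cycle_graph_on[OF this W(2) n] obtain F h where F: "graph_on F W" "\<And>w. w \<in> W \<Longrightarrow> deg F w = 2"
    and h: "bij_betw h {..<n} W"
    and iff: "\<And>i j. i < n \<Longrightarrow> j < n \<Longrightarrow> (h i, h j) \<in> F \<longleftrightarrow> (i, j) \<in> parcs (cycle_graph n)"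
    by blast
  obtain G' where G': "realization G' D" "pverts G' = pverts G" "Restr (parcs G') W = F"
    using replace_induced[OF G W(1) F(1)] F(2) W(3) by (auto simp: two_regular_def)
  have PG: "pair_graph G'" using G'(1) by (simp add: realization_def)
  have v: "pverts (cycle_graph n) = {..<n}" by (simp add: cycle_graph_def)
  have "cycle_graph n \<sqsubseteq>\<^sub>g G'"
    unfolding embeds_iff[OF pair_graph_cycle_graph[OF n] PG] v
  proof (intro exI[of _ h] conjI ballI)
    show "inj_on h {..<n}" "h ` {..<n} \<subseteq> pverts G'" using h W(1) G'(2) by (auto simp: bij_betw_def)
    fix i j assume ij: "i \<in> {..<n}" "j \<in> {..<n}"
    then have "h i \<in> W" "h j \<in> W" using h by (auto simp: bij_betw_def)
    then have "(h i, h j) \<in> parcs G' \<longleftrightarrow> (h i, h j) \<in> F" using G'(3) by auto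
    then show "(h i, h j) \<in> parcs G' \<longleftrightarrow> (i, j) \<in> parcs (cycle_graph n)" using iff ij by simp
  qed
  then show False using forc G'(1) by (auto simp: forcibly_def)
qed

text \<open>\<open>G\<close> is isomorphic to a composition with the concrete
  \<open>cycle_graph m\<close>, whose vertices are the numbers below \<open>m\<close>. Shifting
  \<open>A\<close> and \<open>B\<close> up by \<open>m\<close> keeps them disjoint from it.\<close>

lemma decomposed_compose:
  fixes G :: "nat pair_pre_digraph"
  assumes G: "pair_graph G" "pverts G = A \<union> B \<union> C" and dec: "decomposed (parcs G) A B C"
    and f: "bij_betw f {..<m} C"
      "\<And>i j. i < m \<Longrightarrow> j < m \<Longrightarrow> (f i, f j) \<in> parcs G \<longleftrightarrow> (i, j) \<in> parcs (cycle_graph m)"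
  shows "\<exists>S A' B'. split_graph S \<and> split_partition S A' B' \<and> pverts S \<inter> pverts (cycle_graph m) = {} \<and>
    degree_seq G = degree_seq (split_compose S A' B' (cycle_graph m))"
proof -
  define A' where "A' = (\<lambda>x. x + m) ` A"
  define B' where "B' = (\<lambda>x. x + m) ` B"
  \<comment> \<open>The guards \<open>x \<ge> m\<close> and \<open>y \<ge> m\<close> keep truncated
    subtraction from identifying small numbers with \<open>0\<close>.\<close>
  define S where "S = \<lparr>pverts = A' \<union> B',
    parcs = {(x, y). x \<ge> m \<and> y \<ge> m \<and> (x - m, y - m) \<in> Restr (parcs G) (A \<union> B)}\<rparr>"
  let ?K = "split_compose S A' B' (cycle_graph m)"
  have mem: "x \<in> A' \<longleftrightarrow> m \<le> x \<and> x - m \<in> A" "x \<in> B' \<longleftrightarrow> m \<le> x \<and> x - m \<in> B" for x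
    by (auto simp: A'_def B'_def intro!: image_eqI[of _ _ "x - m"])
  have E: "finite (pverts G)" "graph_on (parcs G) (pverts G)"
    using G by (auto simp: pair_graph_iff_graph_on)
  have comm: "(x, y) \<in> parcs G \<longleftrightarrow> (y, x) \<in> parcs G" and irr: "(x, x) \<notin> parcs G" for x y
    using E by (auto simp: graph_on_def sym_def irrefl_def)
  have S: "pair_graph S"
    unfolding pair_graph_iff
  proof (intro conjI)
    show "finite (pverts S)" using E G(2) by (simp add: S_def A'_def B'_def)
    show "parcs S \<subseteq> pverts S \<times> pverts S" by (auto simp: S_def mem)
    show "sym (parcs S)" using comm by (auto simp: S_def sym_def)
    show "irrefl (parcs S)" using irr by (auto simp: S_def irrefl_def)
  qed
  have part: "split_partition S A' B'"
    unfolding split_partition_def complete_set_def anticomplete_set_def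
  proof (intro conjI ballI impI)
    fix u v assume "u \<in> A'" "v \<in> A'" "u \<noteq> v"
    then have "m \<le> u" "m \<le> v" "u - m \<in> A" "v - m \<in> A" "u - m \<noteq> v - m" by (auto simp: mem)
    then show "(u, v) \<in> parcs S" using dec by (auto simp: S_def decomposed_def)
  qed (use dec in \<open>auto simp: S_def mem decomposed_def\<close>)
  have dis: "pverts S \<inter> pverts (cycle_graph m) = {}"
    by (auto simp: S_def mem cycle_graph_def)
  \<comment> \<open>The isomorphism from \<open>?K\<close> to \<open>G\<close>: \<open>f\<close> on
    the cycle, and the inverse of the shift on \<open>S\<close>.\<close>
  define h where "h = (\<lambda>x. if x < m then f x else x - m)"
  have V: "pverts ?K = A' \<union> B' \<union> {..<m}" by (simp add: split_compose_def S_def cycle_graph_def)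
  have fC: "f i \<in> C" if "i < m" for i using f(1) that by (auto simp: bij_betw_def)
  have "bij_betw h (A' \<union> B') (A \<union> B)"
    by (rule bij_betw_byWitness[of _ "\<lambda>x. x + m"]) (auto simp: h_def A'_def B'_def)
  moreover have "bij_betw h {..<m} C" using f(1) by (subst bij_betw_cong[of _ _ f]) (auto simp: h_def)
  moreover have "(A \<union> B) \<inter> C = {}" using dec by (auto simp: decomposed_def)
  ultimately have bij: "bij_betw h (pverts ?K) (pverts G)"
    unfolding V G(2) by (rule bij_betw_combine[of h "A' \<union> B'" "A \<union> B" "{..<m}" C])
  have iff: "(h u, h v) \<in> parcs G \<longleftrightarrow> (u, v) \<in> parcs ?K" if uv: "u \<in> pverts ?K" "v \<in> pverts ?K" for u v
  proof -
    have CA: "x \<in> C \<Longrightarrow> y \<in> A \<Longrightarrow> (x, y) \<in> parcs G" "x \<in> C \<Longrightarrow> y \<in> B \<Longrightarrow> (x, y) \<notin> parcs G"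
      "x \<in> C \<Longrightarrow> y \<in> A \<Longrightarrow> (y, x) \<in> parcs G" "x \<in> C \<Longrightarrow> y \<in> B \<Longrightarrow> (y, x) \<notin> parcs G"
      "y \<in> A \<Longrightarrow> y \<notin> B" for x y
      using dec comm[of x y] by (auto simp: decomposed_def)
    have K: "(u, v) \<in> parcs ?K \<longleftrightarrow> (u, v) \<in> parcs S \<or> (u, v) \<in> parcs (cycle_graph m) \<or>
        u \<in> A' \<and> v < m \<or> u < m \<and> v \<in> A'"
      by (auto simp: split_compose_def cycle_graph_def)
    consider "u < m" "v < m" | "u < m" "\<not> v < m" "v \<in> A' \<union> B'" | "\<not> u < m" "u \<in> A' \<union> B'" "v < m"
      | "\<not> u < m" "u \<in> A' \<union> B'" "\<not> v < m" "v \<in> A' \<union> B'"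
      using uv unfolding V by auto
    then show ?thesis
    proof cases
      case 1
      then show ?thesis using f(2) unfolding K by (auto simp: h_def S_def mem)
    next
      case 2
      then show ?thesis using CA fC unfolding K by (auto simp: h_def S_def mem cycle_graph_def)
    next
      case 3
      then show ?thesis using CA fC unfolding K by (auto simp: h_def S_def mem cycle_graph_def)
    next
      case 4
      then show ?thesis unfolding K by (auto simp: h_def S_def mem cycle_graph_def)
    qed
  qed
  have sub: "parcs ?K \<subseteq> pverts ?K \<times> pverts ?K"
  proof -
    have "parcs S \<subseteq> (A' \<union> B') \<times> (A' \<union> B')" using S by (simp add: pair_graph_iff S_def)
    then show ?thesis unfolding V by (auto simp: split_compose_def cycle_graph_def)
  qed
  have "parcs G \<subseteq> pverts G \<times> pverts G" using E by (simp add: graph_on_def)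
  then have "degree_seq ?K = degree_seq G"
    by (intro degree_seq_eqI[OF bij] deg_iso[OF bij sub _ iff])
  then show ?thesis using S part dis by (metis split_graph_def)
qed

theorem theorem5:
  fixes n :: nat and D :: "nat list"
  assumes "n \<ge> 4" and "degree_sequence D"
  shows "excludes D (cycle_graph n) \<longleftrightarrow>
    (\<exists>S A B. split_graph S \<and> split_partition S A B \<and>
       pverts S \<inter> pverts (cycle_graph (n + 1)) = {} \<and>
       D = degree_seq (split_compose S A B (cycle_graph (n + 1)))) \<or>
    (\<exists>S A B. split_graph S \<and> split_partition S A B \<and>
       pverts S \<inter> pverts (cycle_graph (n + 2)) = {} \<and>
       D = degree_seq (split_compose S A B (cycle_graph (n + 2)))) \<or>
    forcibly (\<lambda>G. \<forall>m\<ge>n. \<not> cycle_graph m \<sqsubseteq>\<^sub>g G) D"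
proof (intro iffI)
  let ?comp = "\<lambda>m. \<exists>S A B. split_graph S \<and> split_partition S A B \<and>
    pverts S \<inter> pverts (cycle_graph m) = {} \<and> D = degree_seq (split_compose S A B (cycle_graph m))"
  have n3: "n \<ge> 3" using assms(1) by simp
  {
    assume exc: "excludes D (cycle_graph n)"
    show "?comp (n + 1) \<or> ?comp (n + 2) \<or> forcibly (\<lambda>G. \<forall>m\<ge>n. \<not> cycle_graph m \<sqsubseteq>\<^sub>g G) D"
    proof (cases "forcibly (\<lambda>G. \<forall>m\<ge>n. \<not> cycle_graph m \<sqsubseteq>\<^sub>g G) D")
      case False
      then obtain G m where G: "realization G D" and m: "m \<ge> n" "cycle_graph m \<sqsubseteq>\<^sub>g G"
        by (auto simp: forcibly_def)
      have PG: "pair_graph G" "D = degree_seq G" using G by (auto simp: realization_def)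
      have m3: "m \<ge> 3" using m n3 by simp
      obtain f where f: "bij_betw f {..<m} (f ` {..<m})" "f ` {..<m} \<subseteq> pverts G"
        "\<forall>i<m. \<forall>j<m. (f i, f j) \<in> parcs G \<longleftrightarrow> (i, j) \<in> parcs (cycle_graph m)"
        "two_regular (parcs G) (f ` {..<m})"
        by (rule embedded_cycle_two_regular[OF PG(1) m3 m(2)]) (rule that)
      let ?C = "f ` {..<m}"
      have cC: "card ?C = m" using bij_betw_same_card[OF f(1)] by simp
      \<comment> \<open>For \<open>m = n\<close> the embedded cycle would itself be an excluded
        2-regular subgraph.\<close>
      have "m \<noteq> n"
        using exc[unfolded excludes_cycle_iff[OF n3], rule_format, OF G f(2)] f(4) cC by blast
      then interpret missing_cycle n D G ?C
        by unfold_locales (use n3 exc G f m cC in simp_all)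
      obtain A B where AB: "pverts G = A \<union> B \<union> ?C" "decomposed (parcs G) A B ?C"
        by (rule decomposition)
      \<comment> \<open>This holds for the length \<open>m\<close> of the cycle at hand;
        \<open>card_C\<close> then decides which of the two alternatives it is.\<close>
      have comp: "?comp m"
        unfolding PG(2) by (rule decomposed_compose[OF PG(1) AB f(1) f(3)[rule_format]])
      from card_C[unfolded cC] show ?thesis
      proof
        assume "m = n + 1"
        from comp[unfolded this] show ?thesis by (rule disjI1)
      next
        assume "m = n + 2"
        from comp[unfolded this] show ?thesis by (rule disjI2[OF disjI1])
      qed
    qed (rule disjI2[OF disjI2])
  next
    assume comp: "?comp (n + 1) \<or> ?comp (n + 2) \<or> forcibly (\<lambda>G. \<forall>m\<ge>n. \<not> cycle_graph m \<sqsubseteq>\<^sub>g G) D"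
    have compose: "excludes D (cycle_graph n)" if m: "?comp m" "m = n + 1 \<or> m = n + 2" for m
    proof -
      obtain S A B where S: "pair_graph S" "split_partition S A B" "pverts S \<inter> pverts (cycle_graph m) = {}"
        and D: "D = degree_seq (split_compose S A B (cycle_graph m))"
        using m(1) unfolding split_graph_def by blast
      show ?thesis unfolding D by (rule excludes_cycle_if_compose[OF assms(1) S(1,2) m(2) S(3)])
    qed
    from comp show "excludes D (cycle_graph n)"
    proof (elim disjE)
      assume "?comp (n + 1)"
      then show ?thesis by (rule compose) simp
    next
      assume "?comp (n + 2)"
      then show ?thesis by (rule compose) simp
    qed (rule excludes_cycle_if_forcibly[OF n3])
  }
qed

end
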